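(* Fix the clause size $k$. There is a sufficiently large constant $c=c(k)$ such that the following holds for every $m=m(n)$ with $m/n\ge c$. Let $F$ be a random $k$-CNF formula drawn from $\mathcal{P}^{\rm sat}_{n,m}$. Then with high probability $F$ enjoys the following properties: (1) all but $e^{-\Omega(m/n)}n$ of the variables are frozen in $F$; (2) the formula induced by the non-frozen variables decomposes into connected components of at most logarithmic size, i.e. each has $O(\log n)$ variables; (3) letting $\beta(F)$ be the number of satisfying assignments of $F$, we have $\frac1n\log\beta(F)=e^{-\Omega(m/n)}$.
   Context: A $k$-clause over the variables $x_1,\dots,x_n$ is a disjunction of $k$ literals on $k$ distinct variables; there are $2^k\binom nk$ of them. The distribution $\mathcal{P}^{\rm sat}_{n,m}$ over satisfiable $k$-CNF formulas (for $m\le 2^k\binom nk$) is defined as follows: take a uniformly random permutation of all $2^k\binom nk$ clauses; starting from the empty formula, scan the first $m$ clauses in the order of the permutation, including each scanned clause if and only if the formula remains satisfiable after its addition; the output is the formula obtained after scanning these $m$ clauses. "With high probability" means with probability tending to $1$ as $n\to\infty$. A variable is frozen in $F$ if it takes the same value in all satisfying assignments of $F$. The formula induced by the non-frozen variables is obtained by setting the frozen variables to their frozen values and simplifying: every clause containing a TRUE literal is removed, and FALSE literals are removed from the other clauses. The connected components of a formula are those of the graph whose vertices are its variables and in which two variables are adjacent if some clause contains both (with any signs); the size is the number of variables. A quantity written as $e^{-\Omega(m/n)}$ is understood as an upper bound: it is at most $e^{-c' m/n}$ for some constant $c'>0$ independent of $n$ and $m$. *)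

theory Defs
  imports "HOL-Probability.Probability" "HOL-Combinatorics.Multiset_Permutations"
begin

text \<open>A literal is a variable index together with the truth value that makes the literal true.
  The variables are \<open>1, \<dots>, n\<close>.\<close>

type_synonym literal = "nat \<times> bool"
type_synonym clause = "literal set"
type_synonym cnf = "clause set"

definition k_clauses :: "nat \<Rightarrow> nat \<Rightarrow> clause set" where
  "k_clauses k n = {C. C \<subseteq> {1..n} \<times> UNIV \<and> card C = k \<and> inj_on fst C}"

definition sat_clause :: "(nat \<Rightarrow> bool) \<Rightarrow> clause \<Rightarrow> bool" where
  "sat_clause \<sigma> C \<longleftrightarrow> (\<exists>(x, b)\<in>C. \<sigma> x = b)"

text \<open>Assignments are extensional functions on \<open>{1..n}\<close>, so that they can be counted.\<close>

definition sat_assignments :: "nat \<Rightarrow> cnf \<Rightarrow> (nat \<Rightarrow> bool) set" where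
  "sat_assignments n F = {\<sigma> \<in> {1..n} \<rightarrow>\<^sub>E UNIV. \<forall>C\<in>F. sat_clause \<sigma> C}"

definition satisfiable :: "nat \<Rightarrow> cnf \<Rightarrow> bool" where
  "satisfiable n F \<longleftrightarrow> sat_assignments n F \<noteq> {}"

definition scan_clause :: "nat \<Rightarrow> cnf \<Rightarrow> clause \<Rightarrow> cnf" where
  "scan_clause n F C = (if satisfiable n (insert C F) then insert C F else F)"

definition P_sat :: "nat \<Rightarrow> nat \<Rightarrow> nat \<Rightarrow> cnf pmf" where
  "P_sat k n m =
     map_pmf (\<lambda>Cs. foldl (scan_clause n) {} (take m Cs))
       (pmf_of_set (permutations_of_set (k_clauses k n)))"

definition frozen :: "nat \<Rightarrow> cnf \<Rightarrow> nat \<Rightarrow> bool" where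
  "frozen n F x \<longleftrightarrow> (\<exists>b. \<forall>\<sigma>\<in>sat_assignments n F. \<sigma> x = b)"

definition nonfrozen_vars :: "nat \<Rightarrow> cnf \<Rightarrow> nat set" where
  "nonfrozen_vars n F = {x \<in> {1..n}. \<not> frozen n F x}"

text \<open>The partial assignment of the frozen variables. The description is well defined whenever
  \<open>F\<close> is satisfiable.\<close>

definition frozen_assignment :: "nat \<Rightarrow> cnf \<Rightarrow> nat \<rightharpoonup> bool" where
  "frozen_assignment n F x =
     (if x \<in> {1..n} \<and> frozen n F x then Some (THE b. \<forall>\<sigma>\<in>sat_assignments n F. \<sigma> x = b) else None)"

definition simplify :: "(nat \<rightharpoonup> bool) \<Rightarrow> cnf \<Rightarrow> cnf" where
  "simplify \<rho> F =
     (\<lambda>C. {(x, b) \<in> C. \<rho> x \<noteq> Some (\<not> b)}) ` {C \<in> F. \<not> (\<exists>(x, b)\<in>C. \<rho> x = Some b)}"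

definition induced_nonfrozen :: "nat \<Rightarrow> cnf \<Rightarrow> cnf" where
  "induced_nonfrozen n F = simplify (frozen_assignment n F) F"

definition var_adj :: "cnf \<Rightarrow> (nat \<times> nat) set" where
  "var_adj F = {(x, y). x \<noteq> y \<and> (\<exists>C\<in>F. x \<in> fst ` C \<and> y \<in> fst ` C)}"

text \<open>Vertex sets of the connected components of the formula \<open>F\<close> over the variable set \<open>V\<close>.
  A variable of \<open>V\<close> that occurs in no clause forms a component of its own.\<close>

definition formula_components :: "nat set \<Rightarrow> cnf \<Rightarrow> nat set set" where
  "formula_components V F = V // ((var_adj F \<inter> V \<times> V)\<^sup>* \<inter> V \<times> V)"

lemma finite_k_clauses: "finite (k_clauses k n)"
  by (rule finite_subset[of _ "Pow ({1..n} \<times> UNIV)"]) (auto simp: k_clauses_def)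

lemma card_k_clauses: "card (k_clauses k n) = 2 ^ k * (n choose k)"
proof -
  let ?S = "{S. S \<subseteq> {1..n} \<and> card S = k}"
  let ?g = "\<lambda>(S, f). (\<lambda>x. (x, f x)) ` S"
  have "bij_betw ?g (SIGMA S:?S. S \<rightarrow>\<^sub>E (UNIV :: bool set)) (k_clauses k n)"
  proof (rule bij_betwI[where g = "\<lambda>C. (fst ` C, restrict (\<lambda>x. (x, True) \<in> C) (fst ` C))"])
    show "?g \<in> (SIGMA S:?S. S \<rightarrow>\<^sub>E UNIV) \<rightarrow> k_clauses k n"
      by (auto simp: k_clauses_def inj_on_def card_image)
    show "(\<lambda>C. (fst ` C, restrict (\<lambda>x. (x, True) \<in> C) (fst ` C)))
      \<in> k_clauses k n \<rightarrow> (SIGMA S:?S. S \<rightarrow>\<^sub>E UNIV)"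
      by (auto simp: k_clauses_def card_image)
  next
    fix p assume "p \<in> (SIGMA S:?S. S \<rightarrow>\<^sub>E (UNIV :: bool set))"
    then obtain S f where p: "p = (S, f)" "f \<in> S \<rightarrow>\<^sub>E UNIV" by auto
    have 1: "fst ` ?g p = S" by (force simp: p(1))
    have 2: "restrict (\<lambda>x. (x, True) \<in> ?g p) S = f"
      using p(2) by (auto simp: p(1) restrict_def fun_eq_iff PiE_def extensional_def)
    show "(fst ` ?g p, restrict (\<lambda>x. (x, True) \<in> ?g p) (fst ` ?g p)) = p"
      unfolding 1 2 by (simp add: p(1))
  next
    fix C assume C: "C \<in> k_clauses k n"
    then have inj: "inj_on fst C" by (simp add: k_clauses_def)
    have "(x, (x, True) \<in> C) = (x, b)" if "(x, b) \<in> C" for x b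
      using inj_onD[OF inj, of "(x, True)" "(x, b)"] that by (cases b) auto
    then show "?g (fst ` C, restrict (\<lambda>x. (x, True) \<in> C) (fst ` C)) = C"
      by (force simp: image_iff)
  qed
  then have "card (k_clauses k n) = card (SIGMA S:?S. S \<rightarrow>\<^sub>E (UNIV :: bool set))"
    by (simp add: bij_betw_same_card)
  also have "\<dots> = (\<Sum>S\<in>?S. card (S \<rightarrow>\<^sub>E (UNIV :: bool set)))"
    by (rule card_SigmaI) (auto intro!: finite_PiE intro: finite_subset)
  also have "\<dots> = (\<Sum>S\<in>?S. 2 ^ k)"
  proof (rule sum.cong)
    fix S assume "S \<in> ?S"
    then have "finite S" "card S = k" using finite_subset by auto
    then show "card (S \<rightarrow>\<^sub>E (UNIV :: bool set)) = 2 ^ k" by (simp add: card_PiE)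
  qed simp
  also have "\<dots> = 2 ^ k * (n choose k)"
    by (simp add: n_subsets)
  finally show ?thesis .
qed

end

theory Submission
  imports Defs "HOL-Real_Asymp.Real_Asymp"
begin

text \<open>
  A scanned clause is included if one (equivalently, every) satisfying assignment of the final
  formula satisfies it, and is rejected if all of them violate it. Hence, for every satisfying
  assignment \<open>\<sigma>\<close>, the formula consists of exactly those scanned clauses that \<open>\<sigma>\<close> satisfies. Split
  the scanned clauses into two halves.

  A union bound over the \<open>4\<^sup>n\<close> pairs of an assignment and a set of variables shows that after the
  first half any two satisfying assignments are at distance at most \<open>n / 4\<close>, and that no union \<open>U\<close> of
  the disagreement sets with a fixed satisfying assignment has size between \<open>n / 4\<close> and \<open>n / 2\<close>:
  for such a \<open>U\<close> the formula contains no clause that is satisfied only at a variable of \<open>U\<close> and has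
  its other variables outside \<open>U\<close>. So at least half of the variables are frozen already.

  For a variable \<open>x\<close> consider the clauses made of the literal \<open>x\<close> and of \<open>k - 1\<close> false literals on
  these frozen variables. If one of them is scanned in the second half, then it freezes \<open>x\<close>, be it
  included (\<open>x\<close> is true) or rejected (\<open>x\<close> is false). The clause sets of different variables are disjoint,
  so \<open>r\<close> given variables all stay unfrozen with probability \<open>exp (- \<Omega> (r m / n))\<close>, even
  jointly with the event that prescribed clauses are scanned. Property (1) is a union bound over sets of
  \<open>r\<close> variables, and (3) follows since there are at most \<open>2\<^sup>r\<close> satisfying assignments when \<open>r\<close> variables
  are unfrozen. A large component contains a set of \<open>j = \<lceil>ln n\<rceil>\<close> clauses that is connected by common
  variables and has distinct unfrozen representatives; a union bound over the at most
  \<open>N \<Delta>\<^bsup>j-1\<^esup> e\<^sup>j\<close> connected sets yields (2), where \<open>N\<close> is the number of clauses and \<open>\<Delta>\<close> bounds the number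
  of clauses meeting a given one.
\<close>

section \<open>Sampling without replacement\<close>

text \<open>Average over ordered samples of \<open>m\<close> distinct elements of \<open>A\<close>; it is \<open>0\<close> if there are none.\<close>

fun draw_avg :: "nat \<Rightarrow> 'a set \<Rightarrow> ('a list \<Rightarrow> real) \<Rightarrow> real" where
  "draw_avg 0 A f = f []"
| "draw_avg (Suc m) A f = (\<Sum>x\<in>A. draw_avg m (A - {x}) (\<lambda>xs. f (x # xs))) / real (card A)"

text \<open>Fixing the first entry leaves a permutation of the remaining set, so averages over
  permutations obey the recursion of \<open>draw_avg\<close>. This links it to the permutation in
  \<open>P_sat\<close>.\<close>

lemma draw_avg_permutations:
  assumes "finite A" "m \<le> card A"
  shows "(\<Sum>xs\<in>permutations_of_set A. f (take m xs)) / fact (card A) = draw_avg m A f"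
  using assms
proof (induction m arbitrary: A f)
  case 0
  then show ?case by (simp add: card_permutations_of_set)
next
  case (Suc m)
  then have A: "A \<noteq> {}" "card A > 0" by auto
  have "(\<Sum>xs\<in>permutations_of_set A. f (take (Suc m) xs)) =
      (\<Sum>x\<in>A. \<Sum>xs\<in>(#) x ` permutations_of_set (A - {x}). f (take (Suc m) xs))"
    unfolding permutations_of_set_nonempty[OF A(1)]
    by (rule sum.UNION_disjoint) (use Suc.prems in auto)
  also have "\<dots> = (\<Sum>x\<in>A. \<Sum>xs\<in>permutations_of_set (A - {x}). f (x # take m xs))"
    by (simp add: sum.reindex)
  also have "\<dots> / fact (card A) =
      (\<Sum>x\<in>A. (\<Sum>xs\<in>permutations_of_set (A - {x}). f (x # take m xs)) / fact (card (A - {x}))) / card A"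
    using A(2) Suc.prems
    by (simp add: sum_divide_distrib field_simps fact_reduce[of "card A"] of_nat_diff
        cong: sum.cong)
  also have "\<dots> = draw_avg (Suc m) A f"
  proof -
    have "(\<Sum>xs\<in>permutations_of_set (A - {x}). f (x # take m xs)) / fact (card (A - {x})) =
        draw_avg m (A - {x}) (\<lambda>xs. f (x # xs))" if "x \<in> A" for x
      by (rule Suc.IH) (use that Suc.prems in auto)
    then show ?thesis by simp
  qed
  finally show ?case .
qed

lemma prob_take_permutation:
  assumes "finite A" "m \<le> card A"
  shows "measure_pmf.prob (pmf_of_set (permutations_of_set A)) {xs. P (take m xs)} =
    draw_avg m A (\<lambda>xs. of_bool (P xs))"
proof -
  let ?S = "permutations_of_set A"
  have "measure_pmf.prob (pmf_of_set ?S) {xs. P (take m xs)} =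
      card (?S \<inter> {xs. P (take m xs)}) / card ?S"
    using assms by (intro measure_pmf_of_set) auto
  also have "real (card (?S \<inter> {xs. P (take m xs)})) = (\<Sum>xs\<in>?S. of_bool (P (take m xs)))"
    by (simp add: of_bool_def sum.If_cases Int_def)
  finally show ?thesis
    using draw_avg_permutations[OF assms, of "\<lambda>xs. of_bool (P xs)"] assms
    by (simp add: card_permutations_of_set)
qed

lemma draw_avg_mono:
  assumes "\<And>xs. set xs \<subseteq> A \<Longrightarrow> distinct xs \<Longrightarrow> length xs = m \<Longrightarrow> f xs \<le> g xs"
  shows "draw_avg m A f \<le> draw_avg m A g"
  using assms
proof (induction m arbitrary: A f g)
  case (Suc m)
  show ?case
    unfolding draw_avg.simps
    by (intro divide_right_mono sum_mono Suc.IH Suc.prems) auto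
qed auto

lemma draw_avg_add: "draw_avg m A (\<lambda>xs. f xs + g xs) = draw_avg m A f + draw_avg m A g"
  by (induction m arbitrary: A f g) (simp_all add: sum.distrib add_divide_distrib)

lemma draw_avg_cmult: "draw_avg m A (\<lambda>xs. c * f xs) = c * draw_avg m A f"
  by (induction m arbitrary: A f) (simp_all add: sum_distrib_left)

lemma draw_avg_zero: "draw_avg m A (\<lambda>_. 0) = 0"
  by (induction m arbitrary: A) simp_all

lemma draw_avg_sum: "draw_avg m A (\<lambda>xs. \<Sum>i\<in>I. f i xs) = (\<Sum>i\<in>I. draw_avg m A (f i))"
  by (induction I rule: infinite_finite_induct) (simp_all add: draw_avg_zero draw_avg_add)

lemma draw_avg_split:
  "draw_avg (m1 + m2) A f = draw_avg m1 A (\<lambda>h. draw_avg m2 (A - set h) (\<lambda>ys. f (h @ ys)))"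
proof (induction m1 arbitrary: A f)
  case (Suc m1)
  have "A - {x} - set h = A - insert x (set h)" for x h by auto
  then show ?case using Suc.IH by simp
qed simp

lemma power_add_ge_two_terms:
  fixes y d :: real
  assumes "y \<ge> 0" "d \<ge> 0"
  shows "y ^ a + real a * d * y ^ (a - 1) \<le> (y + d) ^ a"
proof (induction a)
  case (Suc a)
  have "y ^ Suc a + real (Suc a) * d * y ^ a \<le> (y + d) * (y ^ a + real a * d * y ^ (a - 1))"
    using assms by (cases a) (auto simp: algebra_simps)
  also have "\<dots> \<le> (y + d) * (y + d) ^ a"
    using Suc assms by (intro mult_left_mono) auto
  finally show ?case by simp
qed simp

text \<open>Condition on the first draw: an element of \<open>T\<close> contributes nothing, one of
  \<open>B\<close> lowers the exponent by one, any other leaves it unchanged. \<open>M\<close>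
  bounds the pool from below at every draw, and \<open>z\<close> is the weight of an element of
  \<open>B\<close> that is never drawn: \<open>z = 0\<close> asks for all of \<open>B\<close>, and
  \<open>B = {}\<close> leaves pure avoidance.\<close>

lemma draw_avg_hit_avoid:
  assumes "finite A" "finite B" "T \<subseteq> A" "M > 0" "M + real m \<le> real (card A)"
    and "t \<ge> 0" "t * real (card A) \<le> real (card T)" "z \<ge> 0"
  shows "draw_avg m A (\<lambda>xs. of_bool (T \<inter> set xs = {}) * z ^ card (B - set xs))
    \<le> ((z + m / M) * exp t) ^ card B * exp (- t * m)"
  using assms
proof (induction m arbitrary: A B)
  case 0
  have "z ^ card B \<le> (z * exp t) ^ card B"
    using 0 mult_left_mono[of 1 "exp t" z] by (intro power_mono) auto
  then show ?case by simp
next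
  case (Suc m)
  let ?y = "(z + m / M) * exp t" and ?b = "card B"
  let ?G = "\<lambda>a. ?y ^ a * exp (- t * m)"
  let ?f = "\<lambda>x. draw_avg m (A - {x}) (\<lambda>xs. of_bool (T \<inter> set (x # xs) = {}) * z ^ card (B - set (x # xs)))"
  have y0: "?y \<ge> 0" using Suc.prems by simp
  have fin: "finite T" using Suc.prems finite_subset by auto
  have cA: "real (card A) \<ge> M" "card A > 0" using Suc.prems by auto
  have IH: "?f x \<le> ?G (card (B - {x}))" if x: "x \<in> A" "x \<notin> T" for x
  proof -
    have "card (A - {x}) = card A - 1" using x by simp
    then have c: "real (card (A - {x})) = real (card A) - 1" using cA by simp
    have "B - insert x (set xs) = B - {x} - set xs" for xs by auto
    then have "?f x = draw_avg m (A - {x})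
        (\<lambda>xs. of_bool (T \<inter> set xs = {}) * z ^ card (B - {x} - set xs))"
      using x by simp
    also have "\<dots> \<le> ?G (card (B - {x}))"
    proof (rule Suc.IH)
      have "t * real (card (A - {x})) \<le> t * real (card A)"
        using c Suc.prems by (intro mult_left_mono) auto
      then show "t * real (card (A - {x})) \<le> real (card T)" using Suc.prems by linarith
    qed (use Suc.prems x c in auto)
    finally show ?thesis .
  qed
  have f0: "?f x = 0" if "x \<in> T" for x
    using that by (simp add: draw_avg_zero)
  have "(\<Sum>x\<in>A. ?f x) = (\<Sum>x\<in>A - T. ?f x)"
    using Suc.prems f0 by (intro sum.mono_neutral_right) auto
  also have "\<dots> \<le> (\<Sum>x\<in>A - T. ?G (card (B - {x})))"
    by (intro sum_mono IH) auto
  \<comment> \<open>Elements of \<open>B\<close> are counted with both weights, so that the first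
    term can run over all of \<open>A - T\<close>.\<close>
  also have "\<dots> \<le> (\<Sum>x\<in>A - T. ?G ?b + (if x \<in> B then ?G (?b - 1) else 0))"
    using y0 by (intro sum_mono) auto
  also have "\<dots> = real (card (A - T)) * ?G ?b + real (card ((A - T) \<inter> B)) * ?G (?b - 1)"
    using Suc.prems by (simp add: sum.distrib sum.If_cases Int_def)
  also have "\<dots> \<le> (real (card A) - real (card T)) * ?G ?b + real ?b * ?G (?b - 1)"
  proof -
    have "real (card (A - T)) = real (card A) - real (card T)"
      using Suc.prems fin by (simp add: card_Diff_subset card_mono of_nat_diff)
    moreover have "card ((A - T) \<inter> B) \<le> ?b" using Suc.prems by (intro card_mono) auto
    ultimately show ?thesis using y0 by (intro add_mono mult_right_mono) auto
  qed
  finally have 1: "draw_avg (Suc m) A (\<lambda>xs. of_bool (T \<inter> set xs = {}) * z ^ card (B - set xs))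
      \<le> ((real (card A) - real (card T)) * ?G ?b + real ?b * ?G (?b - 1)) / real (card A)"
    by (simp add: divide_right_mono)
  also have "\<dots> = (real (card A) - real (card T)) / real (card A) * ?G ?b
      + real ?b / real (card A) * ?G (?b - 1)"
    by (simp add: add_divide_distrib)
  also have "\<dots> \<le> exp (- t) * ?G ?b + real ?b / M * ?G (?b - 1)"
  proof (intro add_mono mult_right_mono)
    have "(real (card A) - real (card T)) / real (card A) \<le> 1 - t"
      using Suc.prems cA by (cases "A = {}") (simp_all add: diff_divide_distrib pos_le_divide_eq)
    also have "\<dots> \<le> exp (- t)" using exp_ge_add_one_self[of "-t"] by simp
    finally show "(real (card A) - real (card T)) / real (card A) \<le> exp (- t)" .
    show "real ?b / real (card A) \<le> real ?b / M"
      using cA Suc.prems by (intro divide_left_mono) auto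
  qed (use y0 in auto)
  \<comment> \<open>A draw from \<open>B\<close> has not gained the factor \<open>exp (- t)\<close>.
    It is supplied at the price of \<open>exp t\<close>, which explains this factor in the base of
    the bound.\<close>
  also have "\<dots> = (?y ^ ?b + real ?b * (exp t / M) * ?y ^ (?b - 1)) * exp (- t * Suc m)"
  proof -
    have "exp (- t * Suc m) = exp (- t * m) * exp (- t)"
      by (simp add: algebra_simps flip: exp_add)
    moreover have "exp t * exp (- t) = 1" by (simp flip: exp_add)
    moreover have "e * (Y * E) + b / M * (Y' * E) = (Y + b * (p / M) * Y') * (E * e)"
      if "p * e = 1" for e Y E b Y' p :: real
    proof -
      have "b / M * (Y' * E) = b / M * (Y' * E) * (p * e)" using that by simp
      then show ?thesis by (simp add: algebra_simps)
    qed
    ultimately show ?thesis by metis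
  qed
  also have "\<dots> \<le> (?y + exp t / M) ^ ?b * exp (- t * Suc m)"
    using y0 Suc.prems by (intro mult_right_mono power_add_ge_two_terms) auto
  also have "?y + exp t / M = (z + Suc m / M) * exp t"
    by (simp add: field_simps add_divide_distrib)
  finally show ?case .
qed

section \<open>The scanning process and frozen variables\<close>

definition scan :: "nat \<Rightarrow> clause list \<Rightarrow> cnf" where
  "scan n xs = foldl (scan_clause n) {} xs"

lemma scan_snoc: "scan n (xs @ [C]) = scan_clause n (scan n xs) C"
  by (simp add: scan_def)

lemma satisfiable_empty: "satisfiable n {}"
  by (simp add: satisfiable_def sat_assignments_def PiE_eq_empty_iff)

lemma satisfiable_scan: "satisfiable n (scan n xs)"
proof (induction xs rule: rev_induct)
  case Nil
  then show ?case by (simp add: scan_def satisfiable_empty)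
qed (simp add: scan_snoc scan_clause_def)

lemma scan_subset: "scan n xs \<subseteq> set xs"
proof (induction xs rule: rev_induct)
  case Nil
  then show ?case by (simp add: scan_def)
qed (auto simp: scan_snoc scan_clause_def)

lemma scan_append_mono: "scan n xs \<subseteq> scan n (xs @ ys)"
proof (induction ys rule: rev_induct)
  case (snoc y ys)
  then show ?case
    using scan_snoc[of n "xs @ ys" y] by (auto simp: scan_clause_def)
qed simp

lemma sat_assignments_antimono: "F \<subseteq> G \<Longrightarrow> sat_assignments n G \<subseteq> sat_assignments n F"
  by (auto simp: sat_assignments_def)

text \<open>At the moment of rejection no satisfying assignment of the current formula satisfies the
  clause, and later steps only remove satisfying assignments.\<close>

lemma scan_rejected:
  assumes "C \<in> set xs" "C \<notin> scan n xs" "\<sigma> \<in> sat_assignments n (scan n xs)"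
  shows "\<not> sat_clause \<sigma> C"
  using assms
proof (induction xs rule: rev_induct)
  case (snoc x xs)
  have sub: "scan n xs \<subseteq> scan n (xs @ [x])" by (rule scan_append_mono)
  then have \<sigma>: "\<sigma> \<in> sat_assignments n (scan n xs)" "C \<notin> scan n xs"
    using snoc.prems sat_assignments_antimono[OF sub] by auto
  show ?case
  proof (cases "C = x")
    case True
    then have "\<not> satisfiable n (insert x (scan n xs))"
      using snoc.prems by (auto simp: scan_snoc scan_clause_def split: if_splits)
    then show ?thesis using \<sigma> True by (auto simp: satisfiable_def sat_assignments_def)
  next
    case False
    then show ?thesis using snoc.IH \<sigma> snoc.prems by simp
  qed
qed simp

text \<open>The right-hand side does not mention \<open>\<sigma>\<close>, so all satisfying
  assignments of the final formula agree on every scanned clause.\<close>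

lemma sat_clause_scan_iff:
  assumes "C \<in> set xs" "\<sigma> \<in> sat_assignments n (scan n xs)"
  shows "sat_clause \<sigma> C \<longleftrightarrow> C \<in> scan n xs"
  using assms scan_rejected[OF assms(1)] by (auto simp: sat_assignments_def)

section \<open>Frozen variables and the number of satisfying assignments\<close>

lemma nonfrozen_vars_iff:
  assumes "\<sigma> \<in> sat_assignments n F"
  shows "x \<in> nonfrozen_vars n F \<longleftrightarrow> x \<in> {1..n} \<and> (\<exists>\<tau>\<in>sat_assignments n F. \<tau> x \<noteq> \<sigma> x)"
  using assms by (auto simp: nonfrozen_vars_def frozen_def)

lemma nonfrozen_vars_subset: "nonfrozen_vars n F \<subseteq> {1..n}"
  by (auto simp: nonfrozen_vars_def)

lemma finite_nonfrozen_vars [simp]: "finite (nonfrozen_vars n F)"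
  by (rule finite_subset[OF nonfrozen_vars_subset]) simp

lemma frozen_mono:
  assumes "F \<subseteq> G" "frozen n F x"
  shows "frozen n G x"
proof -
  obtain b where "\<forall>\<sigma>\<in>sat_assignments n F. \<sigma> x = b" using assms(2) by (auto simp only: frozen_def)
  then have "\<forall>\<sigma>\<in>sat_assignments n G. \<sigma> x = b" using sat_assignments_antimono[OF assms(1)] by blast
  then show ?thesis unfolding frozen_def by (rule exI)
qed

lemma nonfrozen_vars_antimono: "F \<subseteq> G \<Longrightarrow> nonfrozen_vars n G \<subseteq> nonfrozen_vars n F"
  using frozen_mono by (auto simp: nonfrozen_vars_def)

lemma card_sat_assignments_le: "card (sat_assignments n F) \<le> 2 ^ card (nonfrozen_vars n F)"
proof -
  let ?Z = "nonfrozen_vars n F"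
  have "inj_on (\<lambda>\<sigma>. restrict \<sigma> ?Z) (sat_assignments n F)"
  proof (rule inj_onI)
    fix \<sigma> \<tau> assume *: "\<sigma> \<in> sat_assignments n F" "\<tau> \<in> sat_assignments n F"
      "restrict \<sigma> ?Z = restrict \<tau> ?Z"
    have "\<sigma> x = \<tau> x" if "x \<in> {1..n}" for x
    proof (cases "x \<in> ?Z")
      case True
      then show ?thesis using fun_cong[OF *(3), of x] by simp
    next
      case False
      then show ?thesis using that *(2) nonfrozen_vars_iff[OF *(1), of x] by auto
    qed
    then show "\<sigma> = \<tau>"
      using *(1,2) by (intro PiE_ext[of \<sigma> "{1..n}" "\<lambda>_. UNIV" \<tau>]) (auto simp: sat_assignments_def)
  qed
  then have "card (sat_assignments n F) \<le> card (?Z \<rightarrow>\<^sub>E (UNIV :: bool set))"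
    by (rule card_inj_on_le) (auto intro!: finite_PiE)
  then show ?thesis by (simp add: card_PiE)
qed

lemma log_card_sat_assignments_le:
  assumes "satisfiable n F"
  shows "ln (real (card (sat_assignments n F))) \<le> real (card (nonfrozen_vars n F))"
proof -
  have "finite (sat_assignments n F)"
    by (rule finite_subset[of _ "{1..n} \<rightarrow>\<^sub>E UNIV"])
      (auto simp: sat_assignments_def intro!: finite_PiE)
  then have "card (sat_assignments n F) > 0"
    using assms by (auto simp: satisfiable_def card_gt_0_iff)
  moreover have "real (card (sat_assignments n F)) \<le> 2 ^ card (nonfrozen_vars n F)"
    using card_sat_assignments_le[of n F] by (metis of_nat_le_iff of_nat_numeral of_nat_power)
  ultimately have "ln (real (card (sat_assignments n F))) \<le> ln (2 ^ card (nonfrozen_vars n F))"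
    by (subst ln_le_cancel_iff) auto
  also have "\<dots> = card (nonfrozen_vars n F) * ln 2" by (simp add: ln_realpow)
  also have "\<dots> \<le> real (card (nonfrozen_vars n F)) * 1"
    using ln_le_minus_one[of "2::real"] by (intro mult_left_mono) simp_all
  finally show ?thesis by simp
qed

section \<open>Clauses that test a single variable\<close>

definition test_clause :: "(nat \<Rightarrow> bool) \<Rightarrow> nat \<Rightarrow> nat set \<Rightarrow> clause" where
  "test_clause \<sigma> x Y = insert (x, \<sigma> x) ((\<lambda>y. (y, \<not> \<sigma> y)) ` Y)"

definition test_clauses :: "nat \<Rightarrow> (nat \<Rightarrow> bool) \<Rightarrow> nat set \<Rightarrow> nat set \<Rightarrow> clause set" where
  "test_clauses k \<sigma> W H = (\<lambda>(x, Y). test_clause \<sigma> x Y) ` (W \<times> {Y. Y \<subseteq> H \<and> card Y = k - 1})"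

text \<open>Every literal at \<open>Y\<close> is false under \<open>\<sigma>\<close>, hence under
  \<open>\<tau>\<close>, so only the literal at \<open>x\<close> can decide.\<close>

lemma sat_test_clause:
  assumes "x \<notin> Y" "\<And>y. y \<in> Y \<Longrightarrow> \<tau> y = \<sigma> y"
  shows "sat_clause \<tau> (test_clause \<sigma> x Y) \<longleftrightarrow> \<tau> x = \<sigma> x"
  using assms by (auto simp: sat_clause_def test_clause_def)

lemma test_clauses_subset:
  assumes "W \<subseteq> {1..n}" "H \<subseteq> {1..n}" "W \<inter> H = {}" "k \<ge> 1"
  shows "test_clauses k \<sigma> W H \<subseteq> k_clauses k n"
proof
  fix C assume "C \<in> test_clauses k \<sigma> W H"
  then obtain x Y where C: "C = test_clause \<sigma> x Y" "x \<in> W" "Y \<subseteq> H" "card Y = k - 1"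
    by (auto simp: test_clauses_def)
  then have "x \<notin> Y" "finite Y" using assms finite_subset[of Y "{1..n}"] by auto
  moreover have "card ((\<lambda>y. (y, \<not> \<sigma> y)) ` Y) = card Y" by (intro card_image inj_onI) auto
  moreover have "(x, \<sigma> x) \<notin> (\<lambda>y. (y, \<not> \<sigma> y)) ` Y" by auto
  ultimately have "card C = k" using C(4) assms(4) unfolding C(1) test_clause_def by simp
  moreover have "inj_on fst C" using \<open>x \<notin> Y\<close> unfolding C(1) test_clause_def inj_on_def by auto
  moreover have "C \<subseteq> {1..n} \<times> UNIV"
    using C(2,3) assms(1,2) unfolding C(1) test_clause_def by blast
  ultimately show "C \<in> k_clauses k n" by (simp add: k_clauses_def)
qed

text \<open>Since \<open>W\<close> and \<open>H\<close> are disjoint, the variable set of a test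
  clause determines \<open>x\<close>, its only element outside \<open>H\<close>, and
  \<open>Y\<close>.\<close>

lemma card_test_clauses:
  assumes "finite W" "finite H" "W \<inter> H = {}"
  shows "card (test_clauses k \<sigma> W H) = card W * (card H choose (k - 1))"
proof -
  have "inj_on (\<lambda>(x, Y). test_clause \<sigma> x Y) (W \<times> {Y. Y \<subseteq> H \<and> card Y = k - 1})"
  proof (rule inj_onI, clarify)
    fix x Y x' Y' assume *: "x \<in> W" "x' \<in> W" "Y \<subseteq> H" "Y' \<subseteq> H"
      "test_clause \<sigma> x Y = test_clause \<sigma> x' Y'"
    have x: "fst ` test_clause \<sigma> z Z = insert z Z" for z Z
      by (auto simp: test_clause_def image_image)
    have "insert x Y = insert x' Y'" using arg_cong[OF *(5), of "image fst"] by (simp add: x)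
    moreover have "x \<notin> H" "x' \<notin> H" using * assms by auto
    ultimately show "x = x' \<and> Y = Y'" using * by (auto simp: insert_eq_iff)
  qed
  then have "card (test_clauses k \<sigma> W H) = card (W \<times> {Y. Y \<subseteq> H \<and> card Y = k - 1})"
    unfolding test_clauses_def by (rule card_image)
  then show ?thesis using assms by (simp add: card_cartesian_product n_subsets)
qed

text \<open>An included test clause at \<open>x\<close> forces \<open>x\<close> to be true and a rejected one forces it to be
  false, so either way it freezes \<open>x\<close>.\<close>

lemma nonfrozen_avoids_test_clauses:
  fixes n h ys
  defines "F\<^sub>1 \<equiv> scan n h" and "F \<equiv> scan n (h @ ys)"
  assumes \<rho>: "\<rho> \<in> sat_assignments n F\<^sub>1" and W: "W \<subseteq> nonfrozen_vars n F"
    and H: "H \<subseteq> {1..n} - nonfrozen_vars n F\<^sub>1"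
  shows "test_clauses k (\<lambda>x. x \<in> W \<or> \<rho> x) W H \<inter> set (h @ ys) = {}"
proof -
  have sub: "F\<^sub>1 \<subseteq> F" unfolding F\<^sub>1_def F_def by (rule scan_append_mono)
  have WH: "W \<inter> H = {}" using W H nonfrozen_vars_antimono[OF sub, of n] by auto
  have False if C: "C \<in> test_clauses k (\<lambda>x. x \<in> W \<or> \<rho> x) W H" "C \<in> set (h @ ys)" for C
  proof -
    obtain x Y where x: "C = test_clause (\<lambda>x. x \<in> W \<or> \<rho> x) x Y" "x \<in> W" "Y \<subseteq> H"
      using C by (auto simp: test_clauses_def)
    \<comment> \<open>The reference assignment equals \<open>\<rho>\<close> on \<open>H\<close> and
      is true on \<open>W\<close>, whatever \<open>\<rho>\<close> is there. As \<open>h\<close>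
      already freezes \<open>Y\<close>, the truth value of \<open>C\<close> under
      \<open>\<sigma>\<close> is just \<open>\<sigma> x\<close>.\<close>
    have "\<sigma> x = (C \<in> F)" if \<sigma>: "\<sigma> \<in> sat_assignments n F" for \<sigma>
    proof -
      have "\<sigma> y = \<rho> y" if "y \<in> Y" for y
        using nonfrozen_vars_iff[OF \<rho>, of y] that x H \<sigma> sat_assignments_antimono[OF sub, of n]
        by auto
      then have "sat_clause \<sigma> C \<longleftrightarrow> \<sigma> x"
        using sat_test_clause[of x Y \<sigma> "\<lambda>x. x \<in> W \<or> \<rho> x"] x WH by auto
      then show ?thesis using sat_clause_scan_iff[OF C(2), of \<sigma> n] \<sigma> by (simp add: F_def)
    qed
    then have "frozen n F x" by (auto simp: frozen_def)
    then show False using W x by (auto simp: nonfrozen_vars_def)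
  qed
  then show ?thesis by blast
qed

section \<open>Disagreement sets of satisfying assignments\<close>

definition violated_within :: "nat \<Rightarrow> (nat \<Rightarrow> bool) \<Rightarrow> nat set \<Rightarrow> clause set" where
  "violated_within k \<tau> D = (\<lambda>X. (\<lambda>x. (x, \<not> \<tau> x)) ` X) ` {X. X \<subseteq> D \<and> card X = k}"

lemma card_violated_within: "finite D \<Longrightarrow> card (violated_within k \<tau> D) = card D choose k"
proof -
  assume D: "finite D"
  have "inj_on (image (\<lambda>x. (x, \<not> \<tau> x))) {X. X \<subseteq> D \<and> card X = k}"
    by (rule inj_on_image) (simp add: inj_on_def)
  then show ?thesis
    using D by (simp add: violated_within_def card_image n_subsets)
qed

lemma violated_within_subset: "D \<subseteq> {1..n} \<Longrightarrow> violated_within k \<tau> D \<subseteq> k_clauses k n"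
proof
  fix C assume "D \<subseteq> {1..n}" "C \<in> violated_within k \<tau> D"
  then obtain X where X: "C = (\<lambda>x. (x, \<not> \<tau> x)) ` X" "X \<subseteq> {1..n}" "card X = k"
    unfolding violated_within_def by blast
  have "inj_on (\<lambda>x. (x, \<not> \<tau> x)) X" "inj_on fst C" by (auto simp: X(1) inj_on_def)
  then show "C \<in> k_clauses k n" using X by (auto simp: k_clauses_def card_image)
qed

text \<open>The first condition excludes \<open>U\<close> as the disagreement set of two satisfying assignments, the
  second one excludes \<open>U\<close> as a union of disagreement sets with \<open>\<sigma>\<close>.\<close>

definition discriminating :: "nat \<Rightarrow> nat \<Rightarrow> clause list \<Rightarrow> bool" where
  "discriminating k n h \<longleftrightarrow> (\<forall>\<sigma>\<in>{1..n} \<rightarrow>\<^sub>E UNIV. \<forall>U\<in>Pow {1..n}.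
     (n \<le> 4 * card U \<longrightarrow> violated_within k \<sigma> U \<inter> set h \<noteq> {}) \<and>
     (n \<le> 4 * card U \<and> 2 * card U \<le> n \<longrightarrow> test_clauses k \<sigma> U ({1..n} - U) \<inter> set h \<noteq> {}))"

text \<open>Adding the sets one at a time enlarges the union by at most \<open>n / 4\<close> per
  step, so it cannot jump over the window from \<open>n / 4\<close> to \<open>n / 2\<close>.\<close>

lemma subfamily_union_card:
  assumes "finite \<D>" "\<And>D. D \<in> \<D> \<Longrightarrow> finite D \<and> 4 * card D \<le> n" "n < 4 * card (\<Union>\<D>)"
  shows "\<exists>\<E>\<subseteq>\<D>. n \<le> 4 * card (\<Union>\<E>) \<and> 2 * card (\<Union>\<E>) \<le> n"
  using assms
proof (induction \<D>)
  case (insert D \<D>)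
  show ?case
  proof (cases "n < 4 * card (\<Union>\<D>)")
    case True
    then obtain \<E> where "\<E> \<subseteq> \<D>" "n \<le> 4 * card (\<Union>\<E>)" "2 * card (\<Union>\<E>) \<le> n"
      using insert.IH[OF insert.prems(1)[OF insertI2]] by auto
    then show ?thesis by (intro exI[of _ \<E>]) auto
  next
    case False
    have "card (\<Union>(insert D \<D>)) \<le> card D + card (\<Union>\<D>)" by (simp add: card_Un_le)
    then have "2 * card (\<Union>(insert D \<D>)) \<le> n" using False insert.prems(1)[of D] by simp
    then show ?thesis using insert.prems(2) by (intro exI[of _ "insert D \<D>"]) auto
  qed
qed simp

text \<open>The non-frozen variables are the union of the disagreement sets with a fixed satisfying
  \<open>\<sigma>\<close>. Each of these is small by the first condition, so if the union exceeded
  \<open>n / 2\<close>, some subfamily would have its union in the window excluded by the second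
  condition.\<close>

lemma card_nonfrozen_if_discriminating:
  assumes "discriminating k n h" "k \<ge> 1"
  shows "2 * card (nonfrozen_vars n (scan n h)) \<le> n"
proof (rule ccontr)
  let ?F = "scan n h"
  assume *: "\<not> ?thesis"
  obtain \<sigma> where \<sigma>: "\<sigma> \<in> sat_assignments n ?F"
    using satisfiable_scan by (auto simp: satisfiable_def)
  define D where "D = (\<lambda>\<tau>. {x\<in>{1..n}. \<tau> x \<noteq> \<sigma> x})"
  have D_subset: "D \<tau> \<subseteq> {1..n}" for \<tau> by (auto simp: D_def)
  have sat_ext: "\<tau> \<in> {1..n} \<rightarrow>\<^sub>E UNIV" if "\<tau> \<in> sat_assignments n ?F" for \<tau>
    using that by (simp add: sat_assignments_def)
  have small: "4 * card (D \<tau>) \<le> n" if \<tau>: "\<tau> \<in> sat_assignments n ?F" for \<tau>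
  proof (rule ccontr)
    assume "\<not> ?thesis"
    then have "violated_within k \<tau> (D \<tau>) \<inter> set h \<noteq> {}"
      using assms D_subset sat_ext[OF \<tau>] unfolding discriminating_def by force
    then obtain X where X: "X \<subseteq> D \<tau>" "card X = k" "(\<lambda>x. (x, \<not> \<tau> x)) ` X \<in> set h" (is "?C \<in> _")
      by (auto simp: violated_within_def)
    \<comment> \<open>The clause is violated by \<open>\<tau>\<close> but satisfied by
      \<open>\<sigma>\<close>, which differs from \<open>\<tau>\<close> on all of
      \<open>X\<close>.\<close>
    have "\<not> sat_clause \<tau> ?C" by (auto simp: sat_clause_def)
    then have "\<not> sat_clause \<sigma> ?C"
      using sat_clause_scan_iff[OF X(3)] \<sigma> \<tau> by metis
    moreover have "X \<noteq> {}" using X(2) assms(2) by auto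
    ultimately show False using X(1) by (auto simp: sat_clause_def D_def)
  qed
  have un: "nonfrozen_vars n ?F = \<Union>(D ` sat_assignments n ?F)"
    by (rule set_eqI) (auto simp: D_def nonfrozen_vars_iff[OF \<sigma>])
  have "finite (D ` sat_assignments n ?F)"
    by (rule finite_subset[of _ "Pow {1..n}"]) (use D_subset in auto)
  then have "\<exists>\<E>\<subseteq>D ` sat_assignments n ?F. n \<le> 4 * card (\<Union>\<E>) \<and> 2 * card (\<Union>\<E>) \<le> n"
  proof (rule subfamily_union_card)
    show "finite E \<and> 4 * card E \<le> n" if "E \<in> D ` sat_assignments n ?F" for E
      using that small finite_subset[OF D_subset] by auto
    show "n < 4 * card (\<Union>(D ` sat_assignments n ?F))" using * unfolding un by linarith
  qed
  then obtain \<E> where \<E>: "\<E> \<subseteq> D ` sat_assignments n ?F" "n \<le> 4 * card (\<Union>\<E>)" "2 * card (\<Union>\<E>) \<le> n"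
    by (elim exE conjE)
  define U where "U = \<Union>\<E>"
  have "U \<subseteq> {1..n}" using \<E>(1) D_subset unfolding U_def by blast
  then have "test_clauses k \<sigma> U ({1..n} - U) \<inter> set h \<noteq> {}"
    using assms \<E> sat_ext[OF \<sigma>] unfolding discriminating_def U_def by blast
  then obtain x Y where x: "x \<in> U" "Y \<subseteq> {1..n} - U" "test_clause \<sigma> x Y \<in> set h"
    by (auto simp: test_clauses_def)
  \<comment> \<open>This \<open>\<tau>\<close> differs from \<open>\<sigma>\<close> at
    \<open>x\<close> but agrees with it on \<open>Y\<close>, which lies outside
    \<open>U\<close>.\<close>
  obtain \<tau> where \<tau>: "\<tau> \<in> sat_assignments n ?F" "x \<in> D \<tau>" "D \<tau> \<subseteq> U"
    using x(1) \<E>(1) unfolding U_def by blast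
  have "sat_clause \<sigma> (test_clause \<sigma> x Y)" by (simp add: sat_clause_def test_clause_def)
  then have "sat_clause \<tau> (test_clause \<sigma> x Y)"
    using sat_clause_scan_iff[OF x(3)] \<sigma> \<tau>(1) by metis
  moreover have "\<tau> y = \<sigma> y" if "y \<in> Y" for y
  proof -
    have "y \<notin> D \<tau>" "y \<in> {1..n}" using that x(2) \<tau>(3) by blast+
    then show ?thesis by (simp add: D_def)
  qed
  ultimately have "\<tau> x = \<sigma> x" using sat_test_clause[of x Y \<tau> \<sigma>] x by auto
  then show False using \<tau>(2) by (simp add: D_def)
qed

section \<open>Connected sets of clauses\<close>

text \<open>With \<open>nb\<close> as adjacency and seed \<open>B = {v}\<close> these are the finite
  connected sets containing \<open>v\<close>. General seeds serve the recursion in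
  \<open>card_grown\<close>.\<close>

inductive grown :: "('a \<Rightarrow> 'a set) \<Rightarrow> 'a set \<Rightarrow> 'a set \<Rightarrow> bool" for nb B where
  grown_base: "grown nb B B"
| grown_step: "grown nb B A \<Longrightarrow> a \<in> A \<Longrightarrow> u \<in> nb a \<Longrightarrow> grown nb B (insert u A)"

lemma grown_superset: "grown nb B A \<Longrightarrow> B \<subseteq> A"
  by (induction rule: grown.induct) auto

lemma finite_grown: "grown nb B A \<Longrightarrow> finite B \<Longrightarrow> finite A"
  by (induction rule: grown.induct) auto

lemma grown_insert: "grown nb B A \<Longrightarrow> grown nb (insert u B) (insert u A)"
proof (induction rule: grown.induct)
  case (grown_step A a v)
  then have "grown nb (insert u B) (insert v (insert u A))"
    by (intro grown.grown_step[OF grown_step.IH, of a v]) auto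
  then show ?case by (simp add: insert_commute)
qed (rule grown.grown_base)

lemma grown_boundary: "grown nb B A \<Longrightarrow> A = B \<or> (\<exists>u\<in>(\<Union>b\<in>B. nb b) - B. u \<in> A)"
proof (induction rule: grown.induct)
  case (grown_step A a u)
  then show ?case by (cases "u \<in> B") auto
qed simp

text \<open>The classical exploration bound on the number of connected sets: decide for one boundary
  element at a time whether it belongs to the set, which is a choice of \<open>s\<close> accepted elements
  among at most \<open>M\<close> inspected ones.\<close>

lemma card_grown:
  assumes nb: "\<And>a. finite (nb a)" "\<And>a. card (nb a) \<le> \<Delta>"
    and "finite B" "card ((\<Union>b\<in>B. nb b) - B - X) + \<Delta> * s \<le> M"
  shows "finite {A. grown nb B A \<and> A \<inter> X = {} \<and> card A = card B + s} \<and>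
    card {A. grown nb B A \<and> A \<inter> X = {} \<and> card A = card B + s} \<le> M choose s"
  using assms(3,4)
proof (induction M arbitrary: B X s)
  define G where "G = (\<lambda>B X s. {A. grown nb B A \<and> A \<inter> X = {} \<and> card A = card B + s})"
  define bd where "bd = (\<lambda>B X. (\<Union>b\<in>B. nb b) - B - X)"
  have zero: "G B X 0 \<subseteq> {B}" if "finite B" for B X
  proof
    fix A assume "A \<in> G B X 0"
    then have "grown nb B A" "card B = card A" by (auto simp: G_def)
    then show "A \<in> {B}"
      using card_subset_eq[of A B] grown_superset[of nb B A] finite_grown[of nb B A] that by auto
  qed
  then have zero': "finite (G B X 0) \<and> card (G B X 0) \<le> M choose 0" if "finite B" for B X M
    using finite_subset[OF zero[OF that, of X]] card_mono[OF _ zero[OF that, of X]] by simp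
  have stuck: "G B X s = {}" if "bd B X = {}" "s > 0" for B X s
  proof (rule ccontr)
    assume "G B X s \<noteq> {}"
    then obtain A where "grown nb B A" "A \<inter> X = {}" "card A = card B + s" unfolding G_def by blast
    moreover from this have "A \<noteq> B" using that(2) by auto
    ultimately show False using grown_boundary[of nb B A] that(1) unfolding bd_def by blast
  qed
  {
    case 0
    then have "bd B X = {}" using nb(1) by (simp add: bd_def)
    then have "finite (G B X s) \<and> card (G B X s) \<le> 0 choose s"
      using zero'[OF 0(1), of X 0] stuck[of B X s] by (cases s) auto
    then show ?case unfolding G_def .
  next
    case (Suc M)
    show ?case
    proof (cases s)
      case 0
      then show ?thesis using zero'[of B X "Suc M"] Suc.prems unfolding G_def by simp
    next
      case (Suc s')
      show ?thesis
      proof (cases "bd B X = {}")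
        case True
        then have "finite (G B X s) \<and> card (G B X s) \<le> Suc M choose s"
          using stuck[of B X s] Suc by simp
        then show ?thesis unfolding G_def .
      next
        case False
        \<comment> \<open>\<open>X\<close> collects the rejected elements. Accepting
          \<open>u\<close> adds at most \<open>\<Delta>\<close> boundary elements, paid for by the
          decrease of \<open>s\<close>; rejecting it removes \<open>u\<close> from the boundary.
          Either way the budget \<open>M\<close> falls by one, and Pascal's rule adds up the two
          branches.\<close>
        then obtain u where u: "u \<in> bd B X" by auto
        have fin: "finite (bd B' X')" if "finite B'" for B' X'
          using that nb(1) by (auto simp: bd_def)
        have le: "card (bd B X) + \<Delta> * s \<le> Suc M" using Suc.prems unfolding bd_def by simp
        have pos: "card (bd B X) > 0" using u fin[OF Suc.prems(1)] by (auto simp: card_gt_0_iff)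
        have uB: "u \<notin> B" using u by (auto simp: bd_def)
        have "bd (insert u B) X \<subseteq> (bd B X - {u}) \<union> nb u" by (auto simp: bd_def)
        then have "card (bd (insert u B) X) \<le> card (bd B X - {u} \<union> nb u)"
          using fin[OF Suc.prems(1)] nb(1) by (intro card_mono) auto
        also have "\<dots> \<le> card (bd B X - {u}) + card (nb u)" by (rule card_Un_le)
        also have "\<dots> \<le> card (bd B X) - 1 + \<Delta>" using u nb(2)[of u] by simp
        finally have "card (bd (insert u B) X) + \<Delta> * s' \<le> M"
          using le pos \<open>s = Suc s'\<close> by simp
        then have 1: "finite (G (insert u B) X s') \<and> card (G (insert u B) X s') \<le> M choose s'"
          unfolding G_def bd_def using Suc.prems(1) by (intro Suc.IH) auto
        have "bd B (insert u X) = bd B X - {u}" by (auto simp: bd_def)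
        then have "card (bd B (insert u X)) + \<Delta> * s \<le> M" using u le pos by simp
        then have 2: "finite (G B (insert u X) s) \<and> card (G B (insert u X) s) \<le> M choose s"
          unfolding G_def bd_def using Suc.prems(1) by (intro Suc.IH) auto
        have sub: "G B X s \<subseteq> G (insert u B) X s' \<union> G B (insert u X) s"
        proof
          fix A assume A: "A \<in> G B X s"
          show "A \<in> G (insert u B) X s' \<union> G B (insert u X) s"
          proof (cases "u \<in> A")
            case True
            then have "grown nb (insert u B) A"
              using grown_insert[of nb B A u] A by (simp add: G_def insert_absorb)
            then show ?thesis using A uB Suc.prems(1) \<open>s = Suc s'\<close> by (simp add: G_def)
          next
            case False
            then show ?thesis using A by (simp add: G_def)
          qed
        qed
        have f: "finite (G B X s)" using sub 1 2 finite_subset by blast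
        have "card (G B X s) \<le> card (G (insert u B) X s') + card (G B (insert u X) s)"
          using card_mono[OF _ sub] 1 2 card_Un_le[of "G (insert u B) X s'" "G B (insert u X) s"]
          by force
        also have "\<dots> \<le> Suc M choose s" using 1 2 \<open>s = Suc s'\<close> by simp
        finally show ?thesis using f unfolding G_def by simp
      qed
    qed
  }
qed

text \<open>The left-hand side is a single term of the binomial expansion of
  \<open>(x + 1) ^ M\<close>.\<close>

lemma choose_mult_power_le: "x \<ge> 0 \<Longrightarrow> real (M choose s) * x ^ s \<le> exp (x * M)"
proof (cases "s \<le> M")
  case True
  assume x: "x \<ge> 0"
  have "real (M choose s) * x ^ s \<le> (\<Sum>i\<le>M. real (M choose i) * x ^ i * 1 ^ (M - i))"
    using x True member_le_sum[of s "{..M}" "\<lambda>i. real (M choose i) * x ^ i"] by simp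
  also have "\<dots> = (x + 1) ^ M" by (simp add: binomial_ring)
  also have "\<dots> \<le> exp x ^ M" using x exp_ge_add_one_self[of x] by (intro power_mono) (auto simp: add.commute)
  also have "\<dots> = exp (x * M)" by (simp add: exp_of_nat_mult[symmetric] mult.commute)
  finally show ?thesis .
qed (simp add: binomial_eq_0)

text \<open>The budget is \<open>\<Delta> * j\<close>: at most \<open>\<Delta>\<close> neighbours of
  the seed, and \<open>\<Delta>\<close> for each of the \<open>j - 1\<close> further elements. The
  binomial is then estimated by \<open>choose_mult_power_le\<close> at
  \<open>x = 1 / \<Delta>\<close>.\<close>

lemma card_grown_singleton:
  assumes nb: "\<And>a. finite (nb a)" "\<And>a. card (nb a) \<le> \<Delta>" and "\<Delta> > 0" "j \<ge> 1"
  shows "finite {A. grown nb {v} A \<and> card A = j}"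
    and "real (card {A. grown nb {v} A \<and> card A = j}) \<le> real \<Delta> ^ (j - 1) * exp (real j)"
proof -
  have "card ((\<Union>b\<in>{v}. nb b) - {v} - {}) \<le> card (nb v)" using nb(1) by (auto intro: card_mono)
  also have "\<dots> \<le> \<Delta>" by (rule nb)
  finally have "card ((\<Union>b\<in>{v}. nb b) - {v} - {}) + \<Delta> * (j - 1) \<le> \<Delta> * j"
    using assms(4) by (cases j) auto
  from card_grown[OF nb _ this]
  have *: "finite {A. grown nb {v} A \<and> card A = j}"
    "card {A. grown nb {v} A \<and> card A = j} \<le> (\<Delta> * j) choose (j - 1)"
    using assms(4) by auto
  show "finite {A. grown nb {v} A \<and> card A = j}" by fact
  have "real ((\<Delta> * j) choose (j - 1)) * (1 / \<Delta>) ^ (j - 1) \<le> exp (1 / \<Delta> * (\<Delta> * j))"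
    using choose_mult_power_le[of "1 / \<Delta>" "\<Delta> * j" "j - 1"] by simp
  then have "real ((\<Delta> * j) choose (j - 1)) \<le> real \<Delta> ^ (j - 1) * exp (real j)"
    using assms(3) by (simp add: field_simps)
  then show "real (card {A. grown nb {v} A \<and> card A = j}) \<le> real \<Delta> ^ (j - 1) * exp (real j)"
    using *(2) by linarith
qed

section \<open>Neighbouring clauses and components of the induced formula\<close>

lemma k_clauses_finite_card:
  assumes "C \<in> k_clauses k n"
  shows "finite C" "card (fst ` C) = k"
  using assms finite_subset[of C "{1..n} \<times> UNIV"] by (auto simp: k_clauses_def card_image)

lemma card_k_clauses_containing:
  assumes "k \<ge> 1"
  shows "card {C \<in> k_clauses k n. x \<in> fst ` C} \<le> 2 ^ k * n ^ (k - 1)"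
proof -
  let ?S = "(UNIV :: bool set) \<times> k_clauses (k - 1) n"
  have "{C \<in> k_clauses k n. x \<in> fst ` C} \<subseteq> (\<lambda>(b, C). insert (x, b) C) ` ?S"
  proof
    fix C assume "C \<in> {C \<in> k_clauses k n. x \<in> fst ` C}"
    then obtain b where C: "C \<in> k_clauses k n" "(x, b) \<in> C" by auto
    have "C - {(x, b)} \<in> k_clauses (k - 1) n"
      using C k_clauses_finite_card[OF C(1)] by (auto simp: k_clauses_def inj_on_diff)
    moreover have "C = insert (x, b) (C - {(x, b)})" using C by auto
    ultimately show "C \<in> (\<lambda>(b, C). insert (x, b) C) ` ?S"
      by (intro image_eqI[of _ _ "(b, C - {(x, b)})"]) auto
  qed
  then have "card {C \<in> k_clauses k n. x \<in> fst ` C} \<le> card ((\<lambda>(b, C). insert (x, b) C) ` ?S)"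
    by (intro card_mono) (auto simp: finite_k_clauses)
  also have "\<dots> \<le> card ?S" by (rule card_image_le) (auto simp: finite_k_clauses)
  also have "\<dots> = 2 ^ k * (n choose (k - 1))"
    using assms by (simp add: card_cartesian_product card_k_clauses power_eq_if)
  also have "n choose (k - 1) \<le> n ^ (k - 1)"
    using binomial_le_pow[of "k - 1" n] by (cases "k - 1 \<le> n") (simp_all add: binomial_eq_0)
  finally show ?thesis by simp
qed

text \<open>The membership test on \<open>C\<close> empties the neighbourhood of everything else, so
  the degree bound holds for every argument, as \<open>card_grown\<close> demands.\<close>

definition clause_neighbours :: "nat \<Rightarrow> nat \<Rightarrow> clause \<Rightarrow> clause set" where
  "clause_neighbours k n C =
     {C' \<in> k_clauses k n. C \<in> k_clauses k n \<and> fst ` C \<inter> fst ` C' \<noteq> {}}"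

lemma finite_clause_neighbours: "finite (clause_neighbours k n C)"
  by (simp add: clause_neighbours_def finite_k_clauses)

lemma card_clause_neighbours:
  assumes "k \<ge> 1"
  shows "card (clause_neighbours k n C) \<le> k * (2 ^ k * n ^ (k - 1))"
proof (cases "C \<in> k_clauses k n")
  case True
  note C = k_clauses_finite_card[OF True]
  have "clause_neighbours k n C = (\<Union>x\<in>fst ` C. {C' \<in> k_clauses k n. x \<in> fst ` C'})"
    using True unfolding clause_neighbours_def by blast
  then have "card (clause_neighbours k n C) \<le> (\<Sum>x\<in>fst ` C. card {C' \<in> k_clauses k n. x \<in> fst ` C'})"
    by (simp only:) (rule card_UN_le, use C in simp)
  also have "\<dots> \<le> (\<Sum>x\<in>fst ` C. 2 ^ k * n ^ (k - 1))"
    by (intro sum_mono card_k_clauses_containing assms)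
  finally show ?thesis using C by simp
qed (simp add: clause_neighbours_def)

text \<open>Reachability of \<open>b\<close> is recorded so that \<open>b\<close> can be placed in
  the component of \<open>x\<close>.\<close>

lemma rtrancl_crossing_edge:
  assumes "(x, y) \<in> R\<^sup>*" "x \<in> W" "y \<notin> W"
  shows "\<exists>a b. (a, b) \<in> R \<and> a \<in> W \<and> b \<notin> W \<and> (x, b) \<in> R\<^sup>*"
  using assms
proof (induction rule: rtrancl_induct)
  case (step y z)
  then show ?case by (cases "y \<in> W") (auto intro: rtrancl_into_rtrancl)
qed simp

text \<open>An edge of the component leaves \<open>W\<close>, and the clause behind it is part of a
  clause of \<open>F\<close>, because simplification only deletes literals.\<close>

lemma component_crossing_clause:
  assumes K: "K \<in> formula_components V (induced_nonfrozen n F)"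
    and W: "W \<subseteq> K" "W \<noteq> {}" "W \<noteq> K"
  shows "\<exists>C\<in>F. \<exists>x\<in>W. \<exists>y\<in>K - W. x \<in> fst ` C \<and> y \<in> fst ` C"
proof -
  define R where "R = var_adj (induced_nonfrozen n F) \<inter> V \<times> V"
  have sym: "sym (R\<^sup>*)"
    by (intro sym_rtrancl) (auto simp: R_def sym_def var_adj_def)
  obtain v where v: "v \<in> V" "K = (R\<^sup>* \<inter> V \<times> V) `` {v}"
    using K by (auto simp: formula_components_def R_def elim!: quotientE)
  obtain x y where x: "x \<in> W" "y \<in> K - W" using W by blast
  have "(x, v) \<in> R\<^sup>*" "(v, y) \<in> R\<^sup>*" using x W v sym by (auto dest: symD)
  then have "(x, y) \<in> R\<^sup>*" by (rule rtrancl_trans)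
  from rtrancl_crossing_edge[OF this x(1)] x(2)
  obtain a b where ab: "(a, b) \<in> R" "a \<in> W" "b \<notin> W" "(x, b) \<in> R\<^sup>*" by auto
  have "(v, x) \<in> R\<^sup>*" using x W v by auto
  then have "(v, b) \<in> R\<^sup>*" using ab(4) by (rule rtrancl_trans)
  then have "b \<in> K" using ab(1) v by (auto simp: R_def)
  obtain C' where C': "C' \<in> induced_nonfrozen n F" "a \<in> fst ` C'" "b \<in> fst ` C'"
    using ab(1) by (auto simp: R_def var_adj_def)
  then obtain C where "C \<in> F" "C' \<subseteq> C"
    by (auto simp: induced_nonfrozen_def simplify_def)
  then show ?thesis using C' ab \<open>b \<in> K\<close> by blast
qed

text \<open>Greedy construction: \<open>j\<close> clauses cover at most \<open>k * j\<close>
  variables. While \<open>K\<close> has more, some clause contains a covered and an uncovered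
  variable of \<open>K\<close>; the uncovered one becomes its representative and differs from the
  earlier ones, which are covered.\<close>

lemma component_clause_tree:
  assumes K: "K \<in> formula_components V (induced_nonfrozen n F)"
    and F: "F \<subseteq> k_clauses k n" and "card K \<ge> 2" and "j \<ge> 1" "k * (j - 1) < card K"
  shows "\<exists>v\<in>F. \<exists>A w. grown (clause_neighbours k n) {v} A \<and> card A = j \<and> A \<subseteq> F \<and>
    inj_on w A \<and> w ` A \<subseteq> K \<and> (\<forall>C\<in>A. w C \<in> fst ` C)"
  using assms(4,5)
proof (induction j rule: nat_induct_at_least)
  case base
  obtain x where x: "x \<in> K" using assms(3) by fastforce
  have "{x} \<noteq> K" using assms(3) by auto
  then obtain C y where "C \<in> F" "y \<in> K" "y \<in> fst ` C"
    using component_crossing_clause[OF K, of "{x}"] x by auto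
  then show ?case
    by (intro bexI[of _ C] exI[of _ "{C}"] exI[of _ "\<lambda>_. y"]) (auto intro: grown_base)
next
  case (Suc j)
  have "k * (j - 1) \<le> k * j" by (intro mult_le_mono2) simp
  then have "k * (j - 1) < card K" by (rule le_less_trans) (use Suc.prems in simp)
  then obtain v A w where A: "v \<in> F" "grown (clause_neighbours k n) {v} A" "card A = j" "A \<subseteq> F"
    "inj_on w A" "w ` A \<subseteq> K" "\<And>C. C \<in> A \<Longrightarrow> w C \<in> fst ` C"
    using Suc.IH by auto
  define W where "W = K \<inter> (\<Union>C\<in>A. fst ` C)"
  have finA: "finite A" using A(3) Suc.hyps by (metis card.infinite not_one_le_zero)
  have finC: "finite (fst ` C)" "card (fst ` C) = k" if "C \<in> A" for C
    using k_clauses_finite_card[of C k n] that A(4) F by auto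
  have "card W \<le> card (\<Union>C\<in>A. fst ` C)" unfolding W_def
    using finA finC by (intro card_mono) auto
  also have "\<dots> \<le> (\<Sum>C\<in>A. card (fst ` C))" by (rule card_UN_le[OF finA])
  also have "\<dots> = k * j" using finC A(3) by simp
  also have "\<dots> < card K" using Suc.prems by simp
  finally have "W \<noteq> K" by auto
  have wW: "w ` A \<subseteq> W"
  proof (rule image_subsetI)
    fix C assume "C \<in> A"
    then have "w C \<in> K" "w C \<in> fst ` C" using A(6,7) by auto
    then show "w C \<in> W" using \<open>C \<in> A\<close> unfolding W_def by blast
  qed
  moreover have "A \<noteq> {}" using A(3) Suc.hyps by auto
  ultimately have "W \<noteq> {}" by auto
  moreover have "W \<subseteq> K" by (simp add: W_def)
  ultimately obtain C x y where C: "C \<in> F" "x \<in> W" "y \<in> K - W" "x \<in> fst ` C" "y \<in> fst ` C"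
    using component_crossing_clause[OF K _ _ \<open>W \<noteq> K\<close>] by auto
  obtain C' where C': "C' \<in> A" "x \<in> fst ` C'" using C(2) by (auto simp: W_def)
  have "C \<notin> A" using C(3,5) unfolding W_def by blast
  have "C \<in> clause_neighbours k n C'"
    using C C' A(4) F unfolding clause_neighbours_def by blast
  then have "grown (clause_neighbours k n) {v} (insert C A)"
    using A(2) C'(1) by (intro grown_step)
  moreover have "inj_on (w(C := y)) (insert C A)"
    using A(5) \<open>C \<notin> A\<close> wW C(3) by (auto simp: inj_on_def)
  moreover have "card (insert C A) = Suc j" using A(3) finA \<open>C \<notin> A\<close> by simp
  moreover have "(w(C := y)) ` insert C A \<subseteq> K" using A(6) C(3) by auto
  moreover have "\<forall>D\<in>insert C A. (w(C := y)) D \<in> fst ` D" using A(7) C(5) by simp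
  moreover have "insert C A \<subseteq> F" using A(4) C(1) by simp
  ultimately show ?case using A(1) by blast
qed

section \<open>Probability bounds\<close>

text \<open>Equality can fail, as the average is \<open>0\<close> when \<open>A\<close> has too few
  elements.\<close>

lemma draw_avg_const_le: "c \<ge> 0 \<Longrightarrow> draw_avg m A (\<lambda>_. c) \<le> c"
proof (induction m arbitrary: A)
  case (Suc m)
  have "(\<Sum>x\<in>A. draw_avg m (A - {x}) (\<lambda>_. c)) \<le> (\<Sum>x\<in>A. c)"
    by (intro sum_mono Suc)
  then have "draw_avg (Suc m) A (\<lambda>_. c) \<le> real (card A) * c / real (card A)"
    unfolding draw_avg.simps by (intro divide_right_mono) auto
  also have "\<dots> \<le> c" using Suc.prems by (cases "card A = 0") auto
  finally show ?case .
qed simp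

text \<open>A lower bound on the fraction of clauses in each of the clause sets used in the union
  bounds.\<close>

definition \<kappa> :: "nat \<Rightarrow> real" where
  "\<kappa> k = 1 / (8 * real k) ^ k"

lemma \<kappa>_bounds:
  assumes "k \<ge> 2"
  shows "\<kappa> k > 0" "4 * \<kappa> k \<le> 1"
proof -
  have "(4::real) \<le> 4 ^ k" using self_le_power[of "4::real" k] assms by simp
  also have "\<dots> \<le> (8 * real k) ^ k" using assms by (intro power_mono) auto
  finally show "\<kappa> k > 0" "4 * \<kappa> k \<le> 1" using assms by (auto simp: \<kappa>_def field_simps)
qed

lemma \<kappa>_mult_power: "\<kappa> k * (2 * x) ^ k = (x / (4 * real k)) ^ k"
proof -
  have "\<kappa> k * (2 * x) ^ k = (2 * x / (8 * real k)) ^ k"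
    unfolding \<kappa>_def by (simp only: power_divide times_divide_eq_left mult_1)
  then show ?thesis by simp
qed

lemma card_k_clauses_upper: "real (card (k_clauses k n)) \<le> (2 * real n) ^ k"
proof -
  have "n choose k \<le> n ^ k"
    using binomial_le_pow[of k n] by (cases "k \<le> n") (simp_all add: binomial_eq_0)
  then have "real (2 ^ k * (n choose k)) \<le> real (2 ^ k * n ^ k)"
    by (intro of_nat_mono mult_le_mono2)
  then show ?thesis by (simp add: card_k_clauses power_mult_distrib)
qed

lemma card_k_clauses_lower:
  assumes "k \<le> n"
  shows "(2 * real n / real k) ^ k \<le> real (card (k_clauses k n))"
proof -
  have "(2 * real n / real k) ^ k = 2 ^ k * (real n / real k) ^ k"
    by (simp add: power_mult_distrib flip: times_divide_eq_right)
  also have "\<dots> \<le> 2 ^ k * real (n choose k)"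
    using binomial_ge_n_over_k_pow_k[OF assms, where 'a = real] by (intro mult_left_mono) auto
  finally show ?thesis by (simp add: card_k_clauses)
qed

text \<open>There are at most \<open>(2 * n) ^ k\<close> clauses, and \<open>d choose k\<close> is
  at least \<open>(d / k) ^ k\<close>. For \<open>d = n / 4\<close> the quotient of these bounds is
  \<open>1 / (8 * k) ^ k\<close>, the origin of \<open>\<kappa>\<close>.\<close>

lemma choose_ge_clause_fraction:
  assumes "k \<ge> 2" "4 * k \<le> n" "n \<le> 4 * d"
  shows "\<kappa> k * real (card (k_clauses k n)) \<le> real (d choose k)"
proof -
  have "\<kappa> k * real (card (k_clauses k n)) \<le> \<kappa> k * (2 * real n) ^ k"
    using \<kappa>_bounds[OF assms(1)] by (intro mult_left_mono card_k_clauses_upper) auto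
  also have "\<dots> = (real n / (4 * real k)) ^ k"
    by (rule \<kappa>_mult_power)
  also have "\<dots> \<le> (real d / real k) ^ k"
    using assms by (intro power_mono) (auto simp: field_simps)
  also have "\<dots> \<le> real (d choose k)"
    using assms by (intro binomial_ge_n_over_k_pow_k) auto
  finally show ?thesis .
qed

text \<open>The exponent is lower by one, which costs a factor \<open>n / (4 * k)\<close>; together
  with the prefactor \<open>4 / n\<close> this leaves \<open>1 / k\<close>. With
  \<open>n / 4\<close> tested variables the fraction is \<open>\<kappa>\<close> again.\<close>

lemma choose_pred_ge_clause_fraction:
  assumes "k \<ge> 2" "4 * k \<le> n" "n \<le> 2 * d"
  shows "4 * \<kappa> k / real n * real (card (k_clauses k n)) \<le> real (d choose (k - 1))"
proof -
  obtain l where l: "k = Suc l" "l \<ge> 1" using assms(1) by (cases k) auto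
  have n: "real n > 0" using assms by auto
  have "4 * \<kappa> k / real n * real (card (k_clauses k n)) \<le> 4 * \<kappa> k / real n * (2 * real n) ^ k"
    using \<kappa>_bounds[OF assms(1)] n by (intro mult_left_mono card_k_clauses_upper) auto
  also have "\<dots> = 4 / real n * (real n / (4 * real k)) ^ k"
    using \<kappa>_mult_power[of k "real n"] by simp
  also have "\<dots> = 1 / real k * (real n / (4 * real k)) ^ l"
  proof -
    have "(real n / (4 * real k)) ^ k = real n / (4 * real k) * (real n / (4 * real k)) ^ l"
      by (subst l(1)) (rule power_Suc)
    moreover have "4 / real n * (real n / (4 * real k)) = 1 / real k" using n by simp
    ultimately show ?thesis by (simp only: mult.assoc[symmetric])
  qed
  also have "\<dots> \<le> 1 * (real n / (4 * real k)) ^ l"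
    using assms by (intro mult_right_mono) auto
  also have "\<dots> \<le> (real d / real l) ^ l"
  proof -
    have "real n * real l \<le> (2 * real d) * (2 * real k)"
      using assms l by (intro mult_mono) auto
    then have "real n / (4 * real k) \<le> real d / real l"
      using l by (simp add: field_simps)
    then show ?thesis by (simp add: power_mono)
  qed
  also have "\<dots> \<le> real (d choose (k - 1))"
    using assms l binomial_ge_n_over_k_pow_k[of l d, where 'a = real] by simp
  finally show ?thesis .
qed

lemma prob_avoid_le:
  assumes "finite A" "T \<subseteq> A" "m < card A" "t \<ge> 0" "t * real (card A) \<le> real (card T)"
  shows "draw_avg m A (\<lambda>xs. of_bool (T \<inter> set xs = {})) \<le> exp (- t * m)"
  using draw_avg_hit_avoid[of A "{}" T "real (card A) - real m" m t 0] assms by simp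

lemma prob_not_discriminating:
  assumes k: "k \<ge> 2" and n: "4 * k \<le> n" and m: "m < card (k_clauses k n)"
  shows "draw_avg m (k_clauses k n) (\<lambda>h. of_bool (\<not> discriminating k n h))
    \<le> 2 * 4 ^ n * exp (- \<kappa> k * m)"
proof -
  let ?U = "k_clauses k n" and ?e = "exp (- \<kappa> k * m)"
  let ?S = "{1..n} \<rightarrow>\<^sub>E (UNIV :: bool set)" and ?P = "Pow {1..n}"
  note fin = finite_k_clauses[of k n] and \<kappa> = \<kappa>_bounds[OF k]
  define f where "f = (\<lambda>\<sigma> V h. of_bool (n \<le> 4 * card V \<and> violated_within k \<sigma> V \<inter> set h = {}) :: real)"
  define g where "g = (\<lambda>\<sigma> V h. of_bool (n \<le> 4 * card V \<and> 2 * card V \<le> n \<and>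
    test_clauses k \<sigma> V ({1..n} - V) \<inter> set h = {}) :: real)"
  have f: "draw_avg m ?U (f \<sigma> V) \<le> ?e" if V: "V \<in> ?P" for \<sigma> V
  proof (cases "n \<le> 4 * card V")
    case True
    have "finite V" using V finite_subset by auto
    then show ?thesis
      using prob_avoid_le[OF fin violated_within_subset m, of V "\<kappa> k" \<sigma>] V True \<kappa>
        choose_ge_clause_fraction[OF k n True] by (simp add: f_def card_violated_within)
  qed (simp add: f_def draw_avg_zero)
  have g: "draw_avg m ?U (g \<sigma> V) \<le> ?e" if V: "V \<in> ?P" for \<sigma> V
  proof (cases "n \<le> 4 * card V \<and> 2 * card V \<le> n")
    case True
    have V': "finite V" using V finite_subset by auto
    have c: "card ({1..n} - V) = n - card V" using V V' by (simp add: card_Diff_subset)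
    let ?T = "test_clauses k \<sigma> V ({1..n} - V)"
    have cT: "card ?T = card V * ((n - card V) choose (k - 1))"
      using V' c by (subst card_test_clauses) auto
    have "\<kappa> k * real (card ?U) = real n / 4 * (4 * \<kappa> k / real n * real (card ?U))"
      using n k by simp
    also have "\<dots> \<le> real (card V) * real ((n - card V) choose (k - 1))"
      using choose_pred_ge_clause_fraction[OF k n, of "n - card V"] True \<kappa>
      by (intro mult_mono) auto
    finally have "\<kappa> k * real (card ?U) \<le> real (card ?T)" by (simp only: cT of_nat_mult)
    moreover have "?T \<subseteq> ?U" using V k by (intro test_clauses_subset) auto
    ultimately show ?thesis
      using prob_avoid_le[OF fin _ m, of ?T "\<kappa> k"] True \<kappa> by (simp add: g_def)
  qed (auto simp: g_def draw_avg_zero)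
  have finS: "finite ?S" by (intro finite_PiE) auto
  have pos: "f \<sigma> V h \<ge> 0" "g \<sigma> V h \<ge> 0" for \<sigma> V h by (simp_all add: f_def g_def)
  have "of_bool (\<not> discriminating k n h) \<le> (\<Sum>\<sigma>\<in>?S. \<Sum>V\<in>?P. f \<sigma> V h + g \<sigma> V h)" for h
  proof (cases "discriminating k n h")
    case False
    then obtain \<sigma> V where \<sigma>: "\<sigma> \<in> ?S" "V \<in> ?P"
      "(n \<le> 4 * card V \<and> violated_within k \<sigma> V \<inter> set h = {}) \<or>
       (n \<le> 4 * card V \<and> 2 * card V \<le> n \<and> test_clauses k \<sigma> V ({1..n} - V) \<inter> set h = {})"
      unfolding discriminating_def by blast
    then have "1 \<le> f \<sigma> V h + g \<sigma> V h" by (auto simp: f_def g_def)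
    also have "\<dots> \<le> (\<Sum>V\<in>?P. f \<sigma> V h + g \<sigma> V h)"
      using \<sigma>(2) pos by (intro member_le_sum add_nonneg_nonneg) auto
    also have "\<dots> \<le> (\<Sum>\<sigma>\<in>?S. \<Sum>V\<in>?P. f \<sigma> V h + g \<sigma> V h)"
      using \<sigma>(1) pos finS by (intro member_le_sum sum_nonneg add_nonneg_nonneg) auto
    finally show ?thesis by simp
  qed (auto intro!: sum_nonneg add_nonneg_nonneg pos)
  then have "draw_avg m ?U (\<lambda>h. of_bool (\<not> discriminating k n h)) \<le>
      draw_avg m ?U (\<lambda>h. \<Sum>\<sigma>\<in>?S. \<Sum>V\<in>?P. f \<sigma> V h + g \<sigma> V h)"
    by (intro draw_avg_mono)
  also have "\<dots> = (\<Sum>\<sigma>\<in>?S. \<Sum>V\<in>?P. draw_avg m ?U (f \<sigma> V) + draw_avg m ?U (g \<sigma> V))"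
    by (simp add: draw_avg_sum draw_avg_add)
  also have "\<dots> \<le> (\<Sum>\<sigma>\<in>?S. \<Sum>V\<in>?P. 2 * ?e)"
  proof (intro sum_mono)
    fix \<sigma> V assume "V \<in> ?P"
    from add_mono[OF f[OF this, of \<sigma>] g[OF this, of \<sigma>]]
    show "draw_avg m ?U (f \<sigma> V) + draw_avg m ?U (g \<sigma> V) \<le> 2 * ?e" by simp
  qed
  also have "\<dots> = 2 ^ n * (2 ^ n * (2 * ?e))" by (simp add: card_PiE card_Pow)
  also have "\<dots> = 2 * 4 ^ n * ?e" by (simp add: power_mult_distrib[symmetric])
  finally show ?thesis .
qed

text \<open>Conditioning on the first half fixes the set of test clauses, so the presence of the clauses \<open>B\<close>
  (possibly in the first half) decouples from the second half avoiding the test clauses.\<close>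

lemma prob_clauses_and_nonfrozen:
  fixes k n m\<^sub>1 m\<^sub>2 W B
  defines "U \<equiv> k_clauses k n" and "m \<equiv> m\<^sub>1 + m\<^sub>2"
  assumes k: "k \<ge> 2" and n: "4 * k \<le> n" and m: "2 * m \<le> card U" and m\<^sub>1: "m\<^sub>1 \<le> m\<^sub>2"
    and W: "W \<subseteq> {1..n}" and B: "finite B"
  shows "draw_avg m U (\<lambda>xs. of_bool (discriminating k n (take m\<^sub>1 xs) \<and> B \<subseteq> set xs \<and>
      W \<subseteq> nonfrozen_vars n (scan n xs)))
    \<le> (6 * real m / card U) ^ card B * exp (- 2 * \<kappa> k * card W * m / n)"
proof -
  note \<kappa> = \<kappa>_bounds[OF k] and fin = finite_k_clauses[of k n, folded U_def]
  \<comment> \<open>\<open>t\<close> bounds the fraction of test clauses from below,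
    \<open>M\<close> the number of clauses still available at any draw (by
    \<open>2 * m \<le> card U\<close>), and \<open>z\<close> is the price of a clause of
    \<open>B\<close> that the first half leaves to the second.\<close>
  define t where "t = 4 * \<kappa> k * card W / n"
  define M where "M = real (card U) / 2"
  define z where "z = m\<^sub>2 / M * exp t"
  have "card U > 0" unfolding U_def using n by (simp add: card_k_clauses)
  then have M: "M > 0" by (simp add: M_def)
  have cW: "card W \<le> n" using card_mono[OF _ W] by simp
  have t: "t \<ge> 0" "t \<le> 1"
  proof -
    show "t \<ge> 0" using \<kappa> by (simp add: t_def)
    have "4 * \<kappa> k * card W \<le> 1 * real n" using \<kappa> cW by (intro mult_mono) auto
    then show "t \<le> 1" using n k by (simp add: t_def)
  qed
  have z: "z \<ge> 0" using M by (simp add: z_def)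
  have inner: "draw_avg m\<^sub>2 (U - set h) (\<lambda>ys. of_bool (discriminating k n h \<and> B \<subseteq> set (h @ ys) \<and>
      W \<subseteq> nonfrozen_vars n (scan n (h @ ys)))) \<le> z ^ card (B - set h) * exp (- t * m\<^sub>2)"
    (is "draw_avg _ _ ?ind \<le> _")
    if h: "set h \<subseteq> U" "distinct h" "length h = m\<^sub>1" for h
  proof (cases "discriminating k n h \<and> W \<subseteq> nonfrozen_vars n (scan n h)")
    case False
    \<comment> \<open>Non-frozen sets only shrink, so the event is already impossible after
      \<open>h\<close>.\<close>
    then have "\<not> (discriminating k n h \<and> W \<subseteq> nonfrozen_vars n (scan n (h @ ys)))" for ys
      using nonfrozen_vars_antimono[OF scan_append_mono, of n n h ys] by blast
    then have "?ind = (\<lambda>_. 0)" by auto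
    then show ?thesis using z by (simp add: draw_avg_zero)
  next
    case True
    obtain \<rho> where \<rho>: "\<rho> \<in> sat_assignments n (scan n h)"
      using satisfiable_scan by (auto simp: satisfiable_def)
    define H where "H = {1..n} - nonfrozen_vars n (scan n h)"
    define T where "T = test_clauses k (\<lambda>x. x \<in> W \<or> \<rho> x) W H"
    have WH: "W \<inter> H = {}" using True by (auto simp: H_def)
    have TU: "T \<subseteq> U" unfolding T_def U_def
      using W WH k by (intro test_clauses_subset) (auto simp: H_def)
    have avoid: "T \<inter> set (h @ ys) = {}" if "W \<subseteq> nonfrozen_vars n (scan n (h @ ys))" for ys
      unfolding T_def using \<rho> that by (rule nonfrozen_avoids_test_clauses) (simp add: H_def)
    have "2 * card (nonfrozen_vars n (scan n h)) \<le> n"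
      using card_nonfrozen_if_discriminating[of k n h] True k by auto
    moreover have "card H = n - card (nonfrozen_vars n (scan n h))"
      unfolding H_def using nonfrozen_vars_subset by (subst card_Diff_subset) auto
    ultimately have "n \<le> 2 * card H" by simp
    from choose_pred_ge_clause_fraction[OF k n this]
    have "real (card W) * (4 * \<kappa> k / real n * real (card U)) \<le> real (card W) * real (card H choose (k - 1))"
      by (intro mult_left_mono) (auto simp: U_def)
    also have "\<dots> = real (card T)"
      unfolding T_def using W WH by (subst card_test_clauses) (auto simp: H_def intro: finite_subset)
    finally have cT: "t * real (card U) \<le> real (card T)" by (simp add: t_def mult_ac)
    have cU: "card (U - set h) = card U - m\<^sub>1"
      using h by (simp add: card_Diff_subset distinct_card)
    \<comment> \<open>As \<open>0 ^ 0 = 1\<close>, the power of \<open>0\<close> indicates that all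
      clauses of \<open>B\<close> missing from \<open>h\<close> are drawn.\<close>
    have "draw_avg m\<^sub>2 (U - set h) ?ind \<le> draw_avg m\<^sub>2 (U - set h)
        (\<lambda>ys. of_bool (T \<inter> set ys = {}) * 0 ^ card (B - set h - set ys))"
    proof (rule draw_avg_mono)
      fix ys
      show "?ind ys \<le> of_bool (T \<inter> set ys = {}) * 0 ^ card (B - set h - set ys)"
      proof (cases "B \<subseteq> set (h @ ys) \<and> W \<subseteq> nonfrozen_vars n (scan n (h @ ys))")
        case True
        then have "B - set h - set ys = {}" "T \<inter> set ys = {}" using avoid[of ys] by auto
        then show ?thesis by (simp only:) simp
      qed auto
    qed
    also have "\<dots> \<le> ((0 + m\<^sub>2 / M) * exp t) ^ card (B - set h) * exp (- t * m\<^sub>2)"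
    proof (rule draw_avg_hit_avoid)
      \<comment> \<open>For the empty continuation \<open>avoid\<close> says that \<open>h\<close>
        itself misses \<open>T\<close>.\<close>
      show "T \<subseteq> U - set h" using TU avoid[of "[]"] True by auto
      show "M + real m\<^sub>2 \<le> real (card (U - set h))" using m by (simp add: cU M_def m_def)
      have "t * real (card (U - set h)) \<le> t * real (card U)"
        using t fin by (intro mult_left_mono) (auto intro: card_mono)
      then show "t * real (card (U - set h)) \<le> real (card T)" using cT by simp
    qed (use M t fin B in auto)
    finally show ?thesis by (simp add: z_def)
  qed
  have "draw_avg m U (\<lambda>xs. of_bool (discriminating k n (take m\<^sub>1 xs) \<and> B \<subseteq> set xs \<and>
      W \<subseteq> nonfrozen_vars n (scan n xs)))
    = draw_avg m\<^sub>1 U (\<lambda>h. draw_avg m\<^sub>2 (U - set h) (\<lambda>ys. of_bool (discriminating k n (take m\<^sub>1 (h @ ys)) \<and>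
        B \<subseteq> set (h @ ys) \<and> W \<subseteq> nonfrozen_vars n (scan n (h @ ys)))))"
    unfolding m_def by (rule draw_avg_split)
  also have "\<dots> \<le> draw_avg m\<^sub>1 U (\<lambda>h. exp (- t * m\<^sub>2) * z ^ card (B - set h))"
  proof (rule draw_avg_mono)
    fix h assume h: "set h \<subseteq> U" "distinct h" "length h = m\<^sub>1"
    have "take m\<^sub>1 (h @ ys) = h" for ys using h by simp
    then show "draw_avg m\<^sub>2 (U - set h) (\<lambda>ys. of_bool (discriminating k n (take m\<^sub>1 (h @ ys)) \<and>
        B \<subseteq> set (h @ ys) \<and> W \<subseteq> nonfrozen_vars n (scan n (h @ ys))))
      \<le> exp (- t * m\<^sub>2) * z ^ card (B - set h)"
      using inner[OF h] by (simp only: mult.commute)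
  qed
  also have "\<dots> = exp (- t * m\<^sub>2) * draw_avg m\<^sub>1 U (\<lambda>h. z ^ card (B - set h))"
    by (rule draw_avg_cmult)
  \<comment> \<open>The same bound, now without a forbidden set, averages the weights
    \<open>z\<close> over the first half.\<close>
  also have "\<dots> \<le> exp (- t * m\<^sub>2) * (z + m\<^sub>1 / M) ^ card B"
    using draw_avg_hit_avoid[of U B "{}" M m\<^sub>1 0 z] fin B M z m
    by (intro mult_left_mono) (auto simp: M_def m_def)
  also have "\<dots> \<le> exp (- 2 * \<kappa> k * card W * m / n) * (6 * real m / card U) ^ card B"
  proof (intro mult_mono power_mono)
    \<comment> \<open>The second half makes up at least half of the draws, which turns the constant
      \<open>4\<close> of \<open>t\<close> into \<open>2\<close>.\<close>
    have "2 * \<kappa> k * card W / n * m \<le> 2 * \<kappa> k * card W / n * (2 * m\<^sub>2)"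
      using \<kappa> m\<^sub>1 by (intro mult_left_mono) (auto simp: m_def)
    also have "\<dots> = t * m\<^sub>2" by (simp add: t_def)
    finally show "exp (- t * m\<^sub>2) \<le> exp (- 2 * \<kappa> k * card W * m / n)" by simp
    \<comment> \<open>The constant \<open>6\<close> arises from \<open>exp t \<le> 3\<close> and
      from \<open>M\<close> being half of \<open>card U\<close>.\<close>
    have "exp t \<le> 3" using t exp_le by (meson exp_le_cancel_iff order_trans)
    then have "z \<le> m\<^sub>2 / M * 3" using M unfolding z_def by (intro mult_left_mono) auto
    moreover have "m\<^sub>1 / M \<le> m\<^sub>1 / M * 3" using M mult_left_mono[of 1 3 "m\<^sub>1 / M"] by simp
    ultimately have "z + m\<^sub>1 / M \<le> m\<^sub>2 / M * 3 + m\<^sub>1 / M * 3" by (rule add_mono)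
    also have "\<dots> = 6 * real m / card U" by (simp add: M_def m_def add_divide_distrib algebra_simps)
    finally show "z + m\<^sub>1 / M \<le> 6 * real m / card U" .
  qed (use z M in auto)
  finally show ?thesis by (simp only: mult.commute)
qed

lemma prob_many_nonfrozen:
  assumes k: "k \<ge> 2" and n: "4 * k \<le> n" and m: "2 * (m\<^sub>1 + m\<^sub>2) \<le> card (k_clauses k n)" "m\<^sub>1 \<le> m\<^sub>2"
  shows "draw_avg (m\<^sub>1 + m\<^sub>2) (k_clauses k n) (\<lambda>xs. of_bool (discriminating k n (take m\<^sub>1 xs) \<and>
      r \<le> card (nonfrozen_vars n (scan n xs))))
    \<le> real (n choose r) * exp (- 2 * \<kappa> k * r * (m\<^sub>1 + m\<^sub>2) / n)"
proof -
  let ?U = "k_clauses k n"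
  let ?\<W> = "{W. W \<subseteq> {1..n} \<and> card W = r}"
  define f where "f = (\<lambda>W xs. of_bool (discriminating k n (take m\<^sub>1 xs) \<and> {} \<subseteq> set xs \<and>
    W \<subseteq> nonfrozen_vars n (scan n xs)) :: real)"
  have fin: "finite ?\<W>" by simp
  have "draw_avg (m\<^sub>1 + m\<^sub>2) ?U (\<lambda>xs. of_bool (discriminating k n (take m\<^sub>1 xs) \<and>
      r \<le> card (nonfrozen_vars n (scan n xs)))) \<le> draw_avg (m\<^sub>1 + m\<^sub>2) ?U (\<lambda>xs. \<Sum>W\<in>?\<W>. f W xs)"
    (is "draw_avg _ _ ?g \<le> _")
  proof (rule draw_avg_mono)
    fix xs
    show "?g xs \<le> (\<Sum>W\<in>?\<W>. f W xs)"
    proof (cases "discriminating k n (take m\<^sub>1 xs) \<and> r \<le> card (nonfrozen_vars n (scan n xs))")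
      case True
      then obtain W where W: "W \<subseteq> nonfrozen_vars n (scan n xs)" "card W = r"
        using obtain_subset_with_card_n by metis
      then have "W \<in> ?\<W>" using nonfrozen_vars_subset by blast
      then have "f W xs \<le> (\<Sum>W\<in>?\<W>. f W xs)"
        using fin by (intro member_le_sum) (auto simp: f_def)
      then show ?thesis using W True by (simp add: f_def)
    qed (auto intro!: sum_nonneg simp: f_def)
  qed
  also have "\<dots> = (\<Sum>W\<in>?\<W>. draw_avg (m\<^sub>1 + m\<^sub>2) ?U (f W))" by (rule draw_avg_sum)
  also have "\<dots> \<le> (\<Sum>W\<in>?\<W>. exp (- 2 * \<kappa> k * r * (m\<^sub>1 + m\<^sub>2) / n))"
  proof (rule sum_mono)
    fix W assume "W \<in> ?\<W>"
    then show "draw_avg (m\<^sub>1 + m\<^sub>2) ?U (f W) \<le> exp (- 2 * \<kappa> k * r * (m\<^sub>1 + m\<^sub>2) / n)"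
      using prob_clauses_and_nonfrozen[OF k n m, of W "{}"] unfolding f_def by simp
  qed
  also have "\<dots> = real (n choose r) * exp (- 2 * \<kappa> k * r * (m\<^sub>1 + m\<^sub>2) / n)"
    by (simp add: n_subsets)
  finally show ?thesis .
qed

text \<open>An isolated variable need not lie in any clause, so a clause tree can only be started in
  a component of size at least \<open>2\<close>.\<close>

definition large_component :: "nat \<Rightarrow> nat \<Rightarrow> cnf \<Rightarrow> bool" where
  "large_component n s F \<longleftrightarrow>
     (\<exists>K\<in>formula_components (nonfrozen_vars n F) (induced_nonfrozen n F). 2 \<le> card K \<and> s < card K)"

lemma formula_components_subset: "K \<in> formula_components V F \<Longrightarrow> K \<subseteq> V"
  by (auto simp: formula_components_def quotient_def)

text \<open>Union bound over a seed clause, a connected set of \<open>j\<close> clauses around it,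
  and one of \<open>k\<close> representatives per clause. The last two factors pay for the presence
  of the clauses and for their unfrozen representatives.\<close>

lemma prob_large_component:
  fixes \<Delta> j k n m\<^sub>1 m\<^sub>2 :: nat
  defines "U \<equiv> k_clauses k n" and "\<Delta> \<equiv> k * (2 ^ k * n ^ (k - 1))" and "m \<equiv> m\<^sub>1 + m\<^sub>2"
  assumes k: "k \<ge> 2" and n: "4 * k \<le> n" and m: "2 * m \<le> card U" "m\<^sub>1 \<le> m\<^sub>2"
    and j: "j \<ge> 1"
  shows "draw_avg m U (\<lambda>xs. of_bool (discriminating k n (take m\<^sub>1 xs) \<and>
      large_component n (k * (j - 1)) (scan n xs)))
    \<le> card U * (real \<Delta> ^ (j - 1) * exp j * (real k ^ j *
        ((6 * real m / card U) ^ j * exp (- 2 * \<kappa> k * j * m / n))))"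
proof -
  define \<A> where "\<A> = (\<lambda>v. {A. grown (clause_neighbours k n) {v} A \<and> card A = j \<and> A \<subseteq> U})"
  define \<V> where "\<V> = (\<lambda>A. PiE A (\<lambda>C. fst ` C) :: (clause \<Rightarrow> nat) set)"
  \<comment> \<open>With injectivity inside the indicator, \<open>w\<close> may range over a full
    product of \<open>k ^ j\<close> functions.\<close>
  define f where "f = (\<lambda>A w xs. of_bool (inj_on w A \<and> discriminating k n (take m\<^sub>1 xs) \<and>
    A \<subseteq> set xs \<and> w ` A \<subseteq> nonfrozen_vars n (scan n xs)) :: real)"
  let ?p = "(6 * real m / card U) ^ j * exp (- 2 * \<kappa> k * j * m / n)"
  note finU = finite_k_clauses[of k n, folded U_def]
  have \<Delta>: "\<Delta> > 0" using k n by (simp add: \<Delta>_def)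
  have nb: "card (clause_neighbours k n C) \<le> \<Delta>" for C
    unfolding \<Delta>_def using k by (intro card_clause_neighbours) auto
  have grown: "finite {A. grown (clause_neighbours k n) {v} A \<and> card A = j}"
    "card {A. grown (clause_neighbours k n) {v} A \<and> card A = j} \<le> real \<Delta> ^ (j - 1) * exp j" for v
    using card_grown_singleton[OF finite_clause_neighbours nb \<Delta> j] by auto
  have sub\<A>: "\<A> v \<subseteq> {A. grown (clause_neighbours k n) {v} A \<and> card A = j}" for v
    by (auto simp: \<A>_def)
  have fin\<A>: "finite (\<A> v)" for v using sub\<A> grown(1) by (rule finite_subset)
  have "real (card (\<A> v)) \<le> card {A. grown (clause_neighbours k n) {v} A \<and> card A = j}" for v
    by (intro of_nat_mono card_mono grown(1) sub\<A>)
  then have card\<A>: "real (card (\<A> v)) \<le> real \<Delta> ^ (j - 1) * exp j" for v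
    using grown(2) by (rule order_trans)
  have \<V>: "finite (\<V> A)" "card (\<V> A) = k ^ j" and finA: "finite A" if A: "A \<in> \<A> v" for A v
  proof -
    show fA: "finite A" using A finU by (auto simp: \<A>_def intro: finite_subset)
    have C: "finite (fst ` C)" "card (fst ` C) = k" if "C \<in> A" for C
      using k_clauses_finite_card[of C k n] that A unfolding \<A>_def U_def by auto
    then show "finite (\<V> A)" unfolding \<V>_def using fA by (intro finite_PiE)
    have "card (\<V> A) = (\<Prod>C\<in>A. card (fst ` C))" unfolding \<V>_def using fA by (rule card_PiE)
    also have "\<dots> = k ^ j" using A C by (simp add: \<A>_def)
    finally show "card (\<V> A) = k ^ j" .
  qed
  have pos: "f A w xs \<ge> 0" for A w xs by (simp add: f_def)
  have "draw_avg m U (\<lambda>xs. of_bool (discriminating k n (take m\<^sub>1 xs) \<and>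
      large_component n (k * (j - 1)) (scan n xs)))
    \<le> draw_avg m U (\<lambda>xs. \<Sum>v\<in>U. \<Sum>A\<in>\<A> v. \<Sum>w\<in>\<V> A. f A w xs)" (is "draw_avg _ _ ?g \<le> _")
  proof (rule draw_avg_mono)
    fix xs assume xs: "set xs \<subseteq> U"
    let ?F = "scan n xs"
    show "?g xs \<le> (\<Sum>v\<in>U. \<Sum>A\<in>\<A> v. \<Sum>w\<in>\<V> A. f A w xs)"
    proof (cases "discriminating k n (take m\<^sub>1 xs) \<and> large_component n (k * (j - 1)) ?F")
      case True
      then obtain K where K: "K \<in> formula_components (nonfrozen_vars n ?F) (induced_nonfrozen n ?F)"
        "2 \<le> card K" "k * (j - 1) < card K" by (auto simp: large_component_def)
      have F: "?F \<subseteq> k_clauses k n" using scan_subset[of n xs] xs unfolding U_def by auto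
      obtain v A w where A: "v \<in> ?F" "grown (clause_neighbours k n) {v} A" "card A = j" "A \<subseteq> ?F"
        "inj_on w A" "w ` A \<subseteq> K" "\<forall>C\<in>A. w C \<in> fst ` C"
        using component_clause_tree[OF K(1) F K(2) j K(3)] by auto
      have K': "K \<subseteq> nonfrozen_vars n ?F" using K(1) by (rule formula_components_subset)
      have v: "v \<in> U" using A(1) F unfolding U_def by auto
      have A\<A>: "A \<in> \<A> v" using A(2-4) F unfolding \<A>_def U_def by auto
      let ?w = "restrict w A"
      have w: "?w \<in> \<V> A" using A(7) by (simp add: \<V>_def restrict_PiE_iff)
      have "A \<subseteq> set xs" using A(4) scan_subset[of n xs] by auto
      moreover have "?w ` A \<subseteq> nonfrozen_vars n ?F" using A(6) K' by auto
      ultimately have "1 \<le> f A ?w xs" using True A(5) unfolding f_def by simp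
      also have "\<dots> \<le> (\<Sum>w\<in>\<V> A. f A w xs)"
        by (rule member_le_sum[OF w pos \<V>(1)[OF A\<A>]])
      also have "\<dots> \<le> (\<Sum>A\<in>\<A> v. \<Sum>w\<in>\<V> A. f A w xs)"
        using A\<A> fin\<A> pos by (intro member_le_sum sum_nonneg) auto
      also have "\<dots> \<le> (\<Sum>v\<in>U. \<Sum>A\<in>\<A> v. \<Sum>w\<in>\<V> A. f A w xs)"
        using v finU pos by (intro member_le_sum sum_nonneg) auto
      finally show ?thesis using True by simp
    qed (auto intro!: sum_nonneg pos)
  qed
  also have "\<dots> = (\<Sum>v\<in>U. \<Sum>A\<in>\<A> v. \<Sum>w\<in>\<V> A. draw_avg m U (f A w))"
    by (simp add: draw_avg_sum)
  also have "\<dots> \<le> (\<Sum>v\<in>U. \<Sum>A\<in>\<A> v. \<Sum>w\<in>\<V> A. ?p)"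
  proof (intro sum_mono)
    fix v A w assume A: "A \<in> \<A> v" and w: "w \<in> \<V> A"
    show "draw_avg m U (f A w) \<le> ?p"
    proof (cases "inj_on w A")
      case True
      have "w ` A \<subseteq> {1..n}"
      proof (rule image_subsetI)
        fix C assume C: "C \<in> A"
        then have "w C \<in> fst ` C" using w by (auto simp: \<V>_def)
        moreover have "C \<subseteq> {1..n} \<times> UNIV" using A C unfolding \<A>_def U_def k_clauses_def by blast
        ultimately show "w C \<in> {1..n}" by auto
      qed
      moreover have "card A = j" "card (w ` A) = j" using A True by (auto simp: \<A>_def card_image)
      ultimately show ?thesis
        using prob_clauses_and_nonfrozen[OF k n m[unfolded m_def U_def], of "w ` A" A] True finA[OF A]
        unfolding f_def m_def U_def by simp
    next
      case False
      then have "f A w = (\<lambda>_. 0)" by (simp add: f_def)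
      then show ?thesis by (simp add: draw_avg_zero)
    qed
  qed
  also have "\<dots> = (\<Sum>v\<in>U. real (card (\<A> v)) * (real k ^ j * ?p))"
    using \<V>(2) by (intro sum.cong refl) simp
  also have "\<dots> \<le> (\<Sum>v\<in>U. (real \<Delta> ^ (j - 1) * exp j) * (real k ^ j * ?p))"
    using card\<A> by (intro sum_mono mult_right_mono) auto
  finally show ?thesis by simp
qed

lemma draw_avg_take_le:
  fixes f :: "'a list \<Rightarrow> real"
  assumes "\<And>xs. f xs \<ge> 0"
  shows "draw_avg (m\<^sub>1 + m\<^sub>2) A (\<lambda>xs. f (take m\<^sub>1 xs)) \<le> draw_avg m\<^sub>1 A f"
  unfolding draw_avg_split
proof (rule draw_avg_mono)
  fix h :: "'a list" assume "length h = m\<^sub>1"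
  then have "(\<lambda>ys. f (take m\<^sub>1 (h @ ys))) = (\<lambda>_. f h)" by auto
  then show "draw_avg m\<^sub>2 (A - set h) (\<lambda>ys. f (take m\<^sub>1 (h @ ys))) \<le> f h"
    using draw_avg_const_le[OF assms] by simp
qed

lemma prob_bad_le:
  fixes \<Delta> j k n m\<^sub>1 m\<^sub>2 :: nat
  defines "U \<equiv> k_clauses k n" and "\<Delta> \<equiv> k * (2 ^ k * n ^ (k - 1))" and "m \<equiv> m\<^sub>1 + m\<^sub>2"
  assumes k: "k \<ge> 2" and n: "4 * k \<le> n" and m: "2 * m \<le> card U" "m\<^sub>1 \<le> m\<^sub>2"
    and j: "j \<ge> 1"
  shows "draw_avg m U (\<lambda>xs. of_bool (r \<le> card (nonfrozen_vars n (scan n xs)) \<or>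
      large_component n (k * (j - 1)) (scan n xs)))
    \<le> 2 * 4 ^ n * exp (- \<kappa> k * m\<^sub>1) + real (n choose r) * exp (- 2 * \<kappa> k * r * m / n) +
      card U * (real \<Delta> ^ (j - 1) * exp j * (real k ^ j *
        ((6 * real m / card U) ^ j * exp (- 2 * \<kappa> k * j * m / n))))"
proof -
  have U: "card U > 0" unfolding U_def using n by (simp add: card_k_clauses)
  let ?d = "\<lambda>xs. discriminating k n (take m\<^sub>1 xs)"
  let ?r = "\<lambda>xs. r \<le> card (nonfrozen_vars n (scan n xs))"
  let ?l = "\<lambda>xs. large_component n (k * (j - 1)) (scan n xs)"
  have "draw_avg m U (\<lambda>xs. of_bool (?r xs \<or> ?l xs)) \<le> draw_avg m U
      (\<lambda>xs. of_bool (\<not> ?d xs) + of_bool (?d xs \<and> ?r xs) + of_bool (?d xs \<and> ?l xs))"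
    by (rule draw_avg_mono) auto
  also have "\<dots> = draw_avg m U (\<lambda>xs. of_bool (\<not> ?d xs)) + draw_avg m U (\<lambda>xs. of_bool (?d xs \<and> ?r xs))
      + draw_avg m U (\<lambda>xs. of_bool (?d xs \<and> ?l xs))"
    by (simp only: draw_avg_add)
  also have "\<dots> \<le> 2 * 4 ^ n * exp (- \<kappa> k * m\<^sub>1) + real (n choose r) * exp (- 2 * \<kappa> k * r * m / n) +
      card U * (real \<Delta> ^ (j - 1) * exp j * (real k ^ j *
        ((6 * real m / card U) ^ j * exp (- 2 * \<kappa> k * j * m / n))))"
  proof (intro add_mono)
    have "draw_avg m U (\<lambda>xs. of_bool (\<not> ?d xs)) \<le> draw_avg m\<^sub>1 U (\<lambda>h. of_bool (\<not> discriminating k n h))"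
      unfolding m_def by (rule draw_avg_take_le) simp
    also have "\<dots> \<le> 2 * 4 ^ n * exp (- \<kappa> k * m\<^sub>1)"
      using m U unfolding U_def m_def by (intro prob_not_discriminating k n) auto
    finally show "draw_avg m U (\<lambda>xs. of_bool (\<not> ?d xs)) \<le> 2 * 4 ^ n * exp (- \<kappa> k * m\<^sub>1)" .
    show "draw_avg m U (\<lambda>xs. of_bool (?d xs \<and> ?r xs)) \<le> real (n choose r) * exp (- 2 * \<kappa> k * r * m / n)"
      using prob_many_nonfrozen[OF k n m[unfolded m_def U_def]] unfolding m_def U_def by simp
    show "draw_avg m U (\<lambda>xs. of_bool (?d xs \<and> ?l xs)) \<le>
      card U * (real \<Delta> ^ (j - 1) * exp j * (real k ^ j *
        ((6 * real m / card U) ^ j * exp (- 2 * \<kappa> k * j * m / n))))"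
      using prob_large_component[OF k n m[unfolded m_def U_def] j] unfolding \<Delta>_def m_def U_def by simp
  qed
  finally show ?thesis .
qed

section \<open>Asymptotics\<close>

definition good_formula :: "real \<Rightarrow> real \<Rightarrow> nat \<Rightarrow> nat \<Rightarrow> cnf \<Rightarrow> bool" where
  "good_formula c' L n m F \<longleftrightarrow>
     real (card (nonfrozen_vars n F)) \<le> exp (- c' * real m / real n) * real n \<and>
     (\<forall>K \<in> formula_components (nonfrozen_vars n F) (induced_nonfrozen n F).
        real (card K) \<le> L * ln (real n)) \<and>
     1 / real n * ln (real (card (sat_assignments n F))) \<le> exp (- c' * real m / real n)"

lemma good_formulaI:
  assumes "satisfiable n F" "n > 0"
    and "real (card (nonfrozen_vars n F)) \<le> exp (- c' * real m / real n) * real n"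
    and "\<And>K. K \<in> formula_components (nonfrozen_vars n F) (induced_nonfrozen n F) \<Longrightarrow>
        real (card K) \<le> L * ln (real n)"
  shows "good_formula c' L n m F"
proof -
  have "ln (real (card (sat_assignments n F))) \<le> exp (- c' * real m / real n) * real n"
    using log_card_sat_assignments_le[OF assms(1)] assms(3) by linarith
  then have "1 / real n * ln (real (card (sat_assignments n F))) \<le> exp (- c' * real m / real n)"
    using assms(2) by (simp add: field_simps)
  then show ?thesis using assms unfolding good_formula_def by blast
qed

lemma prob_P_sat:
  assumes "m \<le> 2 ^ k * (n choose k)"
  shows "measure_pmf.prob (P_sat k n m) {F. Q F} =
    1 - draw_avg m (k_clauses k n) (\<lambda>xs. of_bool (\<not> Q (scan n xs)))"
proof -
  let ?p = "pmf_of_set (permutations_of_set (k_clauses k n))"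
  have "measure_pmf.prob (P_sat k n m) {F. Q F} = measure_pmf.prob ?p {xs. Q (scan n (take m xs))}"
    by (simp add: P_sat_def scan_def vimage_def)
  also have "\<dots> = 1 - measure_pmf.prob ?p {xs. \<not> Q (scan n (take m xs))}"
    using measure_pmf.prob_compl[of "{xs. \<not> Q (scan n (take m xs))}" ?p]
    by (simp add: Compl_eq_Diff_UNIV[symmetric] Collect_neg_eq[symmetric])
  also have "measure_pmf.prob ?p {xs. \<not> Q (scan n (take m xs))} =
      draw_avg m (k_clauses k n) (\<lambda>xs. of_bool (\<not> Q (scan n xs)))"
    by (rule prob_take_permutation) (use assms in \<open>simp_all add: finite_k_clauses card_k_clauses\<close>)
  finally show ?thesis .
qed

text \<open>Dictated by \<open>component_term_le\<close>: there
  \<open>6 * exp 1 * k ^ (k + 2)\<close>, divided by twice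
  \<open>(\<kappa> k)\<^sup>2 * density_threshold k\<close>, must be at most
  \<open>exp (- 2)\<close>; the constant \<open>81\<close> makes it
  \<open>exp 1 / 27\<close>.\<close>

definition density_threshold :: "nat \<Rightarrow> real" where
  "density_threshold k = 81 * real k ^ (k + 2) / (\<kappa> k)\<^sup>2"

lemma density_threshold_ge:
  assumes k: "k \<ge> 2"
  shows "density_threshold k \<ge> 81 / \<kappa> k"
proof -
  note \<kappa> = \<kappa>_bounds[OF k]
  have "81 * \<kappa> k \<le> 81 * real k ^ (k + 2)"
  proof -
    have "\<kappa> k \<le> 1" using \<kappa> by linarith
    also have "1 \<le> real k ^ (k + 2)" using k by (intro one_le_power) auto
    finally show ?thesis by simp
  qed
  then show ?thesis using \<kappa> by (simp add: density_threshold_def field_simps power2_eq_square)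
qed

text \<open>The density makes \<open>\<kappa> k * (m div 2)\<close> at least \<open>2 * n\<close>,
  enough to beat \<open>4 ^ n\<close>.\<close>

lemma discriminating_term_le:
  assumes k: "k \<ge> 2" and n: "n \<ge> 1" and m: "real m / real n \<ge> density_threshold k"
  shows "2 * 4 ^ n * exp (- \<kappa> k * real (m div 2)) \<le> 2 * (4 * exp (- 2)) ^ n"
proof -
  note \<kappa> = \<kappa>_bounds[OF k]
  have "81 / \<kappa> k \<le> real m / real n" using density_threshold_ge[OF k] m by linarith
  then have "81 * real n \<le> \<kappa> k * real m" using \<kappa> n by (simp add: field_simps)
  moreover have "\<kappa> k * real m \<le> \<kappa> k * (2 * real (m div 2) + 1)"
    using \<kappa> by (intro mult_left_mono) linarith+
  moreover have "\<kappa> k * (2 * real (m div 2) + 1) = 2 * (\<kappa> k * real (m div 2)) + \<kappa> k"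
    by (simp add: algebra_simps)
  ultimately have "2 * real n \<le> \<kappa> k * real (m div 2)" using \<kappa> n by linarith
  then have "exp (- \<kappa> k * real (m div 2)) \<le> exp (real n * (- 2))" by simp
  also have "\<dots> = exp (- 2) ^ n" by (rule exp_of_nat_mult)
  finally show ?thesis by (simp add: power_mult_distrib)
qed

text \<open>Of the three factors \<open>y ^ r\<close>, one reduces the binomial to
  \<open>exp r\<close>, one cancels \<open>exp r\<close>, and one decays. As \<open>y\<close> may
  depend on \<open>n\<close> there are two cases: either \<open>y\<close> itself is at most
  \<open>1 / sqrt n\<close>, or \<open>r\<close> is at least \<open>sqrt n\<close>.\<close>

lemma nonfrozen_term_le:
  fixes y :: real
  assumes y: "0 < y" "y \<le> exp (- 1)" and n: "n \<ge> 1" and r: "r \<ge> 1" "y * real n \<le> real r"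
  shows "real (n choose r) * y ^ (3 * r) \<le> 1 / sqrt (real n)"
proof -
  have "real (n choose r) * y ^ r \<le> exp (y * real n)"
    using y by (intro choose_mult_power_le) auto
  also have "\<dots> \<le> exp (real r)" using r by simp
  finally have "real (n choose r) * y ^ r * y ^ (2 * r) \<le> exp (real r) * y ^ (2 * r)"
    using y by (intro mult_right_mono) auto
  moreover have "y ^ r * y ^ (2 * r) = y ^ (3 * r)" by (simp flip: power_add)
  ultimately have "real (n choose r) * y ^ (3 * r) \<le> exp (real r) * y ^ (2 * r)"
    by (simp add: mult.assoc)
  also have "\<dots> = (exp 1 * y) ^ r * y ^ r"
    by (simp add: power_mult_distrib power_mult power2_eq_square flip: exp_of_nat_mult)
  also have "\<dots> \<le> 1 * y ^ r"
  proof (intro mult_right_mono power_le_one)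
    have "exp 1 * y \<le> exp 1 * exp (- 1)" using y by (intro mult_left_mono) auto
    then show "exp 1 * y \<le> 1" by (simp flip: exp_add)
  qed (use y in auto)
  also have "\<dots> \<le> 1 / sqrt (real n)"
  proof (cases "y \<le> 1 / sqrt (real n)")
    case True
    have "y \<le> 1" using y by (smt (verit) exp_le_one_iff)
    then have "y ^ r \<le> y ^ 1" using y r by (intro power_decreasing) auto
    then show ?thesis using True by simp
  next
    case False
    have s: "sqrt (real n) > 0" using n by simp
    have "sqrt (real n) = 1 / sqrt (real n) * real n" using n by (simp add: real_div_sqrt)
    also have "\<dots> \<le> y * real n" using False by (intro mult_right_mono) auto
    finally have r': "sqrt (real n) \<le> real r" using r by linarith
    have "y ^ r \<le> exp (- 1) ^ r" using y by (intro power_mono) auto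
    also have "\<dots> = exp (- real r)" by (simp flip: exp_of_nat_mult)
    also have "\<dots> \<le> exp (- sqrt (real n))" using r' by simp
    also have "\<dots> = 1 / exp (sqrt (real n))" by (simp add: exp_minus field_simps)
    also have "\<dots> \<le> 1 / sqrt (real n)"
    proof (rule divide_left_mono)
      show "sqrt (real n) \<le> exp (sqrt (real n))"
        using exp_ge_add_one_self[of "sqrt (real n)"] by linarith
    qed (use s in auto)
    finally show ?thesis by simp
  qed
  finally show ?thesis .
qed

text \<open>The expression is \<open>N / \<Delta> * X ^ j\<close>, where \<open>X\<close> is the
  cost per clause. The prefactor is at most \<open>n\<close>, and \<open>X \<le> exp (- 2)\<close>
  with \<open>j \<ge> ln n\<close> contributes \<open>1 / n\<^sup>2\<close>.\<close>

lemma component_term_le: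
  fixes k n m j :: nat
  defines "\<Delta> \<equiv> k * (2 ^ k * n ^ (k - 1))" and "N \<equiv> card (k_clauses k n)"
  assumes k: "k \<ge> 2" and n: "k \<le> n" and m: "real m / real n \<ge> density_threshold k"
    and j: "j \<ge> 1" "ln (real n) \<le> real j"
  shows "N * (real \<Delta> ^ (j - 1) * exp j * (real k ^ j *
        ((6 * real m / N) ^ j * exp (- 2 * \<kappa> k * j * m / n)))) \<le> 1 / real n"
proof -
  note \<kappa> = \<kappa>_bounds[OF k]
  define u where "u = real m / real n"
  have n0: "real n > 0" using n k by auto
  have k0: "real k > 0" using k by auto
  have \<Delta>: "real \<Delta> > 0" using n0 k0 by (simp add: \<Delta>_def)
  have N: "real N > 0" unfolding N_def using n by (simp add: card_k_clauses)
  have c: "density_threshold k > 0" using \<kappa> k0 by (simp add: density_threshold_def)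
  then have u: "u > 0" "u \<ge> density_threshold k" using m by (simp_all add: u_def)
  have nk: "real n ^ k = real n * real n ^ (k - 1)" using k by (cases k) auto
  define X where "X = exp 1 * real \<Delta> * real k * (6 * real m / N) * exp (- 2 * \<kappa> k * u)"
  have "real \<Delta> / N \<le> real k ^ (k + 1) / real n"
  proof -
    have "real \<Delta> * real n = real k ^ (k + 1) * (2 * real n / real k) ^ k"
      using k0 nk by (simp add: \<Delta>_def power_divide power_mult_distrib)
    also have "\<dots> \<le> real k ^ (k + 1) * real N"
      unfolding N_def using n by (intro mult_left_mono card_k_clauses_lower) auto
    finally show ?thesis using N n0 by (simp add: field_simps)
  qed
  have "X = 6 * exp 1 * real k * (real \<Delta> / N) * real m * exp (- 2 * \<kappa> k * u)"
    by (simp add: X_def)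
  also have "\<dots> \<le> 6 * exp 1 * real k * (real k ^ (k + 1) / real n) * real m * exp (- 2 * \<kappa> k * u)"
    using \<open>real \<Delta> / N \<le> _\<close> by (intro mult_right_mono mult_left_mono) auto
  also have "\<dots> = 6 * exp 1 * real k ^ (k + 2) * (u * exp (- 2 * \<kappa> k * u))"
    by (simp add: u_def)
  also have "\<dots> \<le> 6 * exp 1 * real k ^ (k + 2) * (1 / (2 * (\<kappa> k)\<^sup>2 * density_threshold k))"
  proof (intro mult_left_mono)
    \<comment> \<open>The quadratic Taylor term of the exponential beats the linear factor
      \<open>u\<close>.\<close>
    have "2 * (\<kappa> k)\<^sup>2 * u\<^sup>2 \<le> 1 + 2 * \<kappa> k * u + (2 * \<kappa> k * u)\<^sup>2 / 2"
      using \<kappa> u by (simp add: power_mult_distrib)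
    also have "\<dots> \<le> exp (2 * \<kappa> k * u)" using \<kappa> u by (intro exp_lower_Taylor_quadratic) auto
    finally have *: "2 * (\<kappa> k)\<^sup>2 * u\<^sup>2 \<le> exp (2 * \<kappa> k * u)" .
    have "u * exp (- 2 * \<kappa> k * u) = u / exp (2 * \<kappa> k * u)" by (simp add: exp_minus divide_inverse)
    also have "\<dots> \<le> u / (2 * (\<kappa> k)\<^sup>2 * u\<^sup>2)"
      using * u \<kappa> by (intro divide_left_mono) auto
    also have "\<dots> = 1 / (2 * (\<kappa> k)\<^sup>2 * u)" using u by (simp add: power2_eq_square)
    also have "\<dots> \<le> 1 / (2 * (\<kappa> k)\<^sup>2 * density_threshold k)"
      using u c \<kappa> by (intro divide_left_mono mult_left_mono) auto
    finally show "u * exp (- 2 * \<kappa> k * u) \<le> 1 / (2 * (\<kappa> k)\<^sup>2 * density_threshold k)" .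
  qed auto
  also have "\<dots> = exp 1 / 27"
    using \<kappa> k0 by (simp add: density_threshold_def field_simps)
  also have "\<dots> \<le> exp (- 2)"
  proof -
    have "exp (1 :: real) ^ 3 \<le> 3 ^ 3" using exp_le by (intro power_mono) auto
    moreover have "exp (1 :: real) ^ 3 = exp 3" "exp 3 = exp 1 / exp (- 2 :: real)"
      by (simp_all flip: exp_of_nat_mult exp_diff)
    ultimately have "exp 1 / exp (- 2) \<le> (27 :: real)" by simp
    then show ?thesis by (simp add: field_simps)
  qed
  finally have X: "X \<le> exp (- 2)" .
  have X0: "X \<ge> 0" by (simp add: X_def)
  have "X ^ j = exp 1 ^ j * real \<Delta> ^ j * real k ^ j * (6 * real m / N) ^ j * exp (- 2 * \<kappa> k * u) ^ j"
    by (simp only: X_def power_mult_distrib)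
  moreover have "exp 1 ^ j = exp (real j)" "exp (- 2 * \<kappa> k * u) ^ j = exp (- 2 * \<kappa> k * j * m / n)"
    by (simp_all add: u_def mult_ac flip: exp_of_nat_mult)
  moreover have "real \<Delta> ^ j = real \<Delta> * real \<Delta> ^ (j - 1)" using j by (cases j) auto
  ultimately have "N * (real \<Delta> ^ (j - 1) * exp j * (real k ^ j *
        ((6 * real m / N) ^ j * exp (- 2 * \<kappa> k * j * m / n)))) = real N / real \<Delta> * X ^ j"
    using \<Delta> by (simp add: mult_ac)
  also have "\<dots> \<le> real n * exp (- 2) ^ j"
  proof (intro mult_mono power_mono X X0)
    have "real N \<le> 1 * (2 ^ k * (real n * real n ^ (k - 1)))"
      using card_k_clauses_upper[of k n] nk by (simp add: N_def power_mult_distrib)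
    also have "\<dots> \<le> real k * (2 ^ k * (real n * real n ^ (k - 1)))"
      using k n0 by (intro mult_right_mono) auto
    finally show "real N / real \<Delta> \<le> real n" using \<Delta> by (simp add: \<Delta>_def field_simps)
  qed (use X0 in auto)
  also have "exp (- 2) ^ j = exp (- (2 * real j))" by (simp add: mult.commute flip: exp_of_nat_mult)
  also have "\<dots> \<le> exp (- (2 * ln (real n)))" using j by simp
  also have "\<dots> = 1 / (real n)\<^sup>2"
    using n0 by (simp add: exp_minus exp_double inverse_eq_divide)
  also have "real n * (1 / (real n)\<^sup>2) = 1 / real n" using n0 by (simp add: power2_eq_square)
  finally show ?thesis using n0 by simp
qed

definition failure_bound :: "nat \<Rightarrow> real" where
  "failure_bound n = 2 * (4 * exp (- 2)) ^ n + 1 / sqrt (real n) + 1 / real n"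

lemma failure_bound_tendsto: "failure_bound \<longlonglongrightarrow> 0"
proof -
  have "4 * exp (- 2 :: real) < 1"
  proof -
    have "(4 :: real) < 1 + 2 + 2\<^sup>2 / 2" by simp
    also have "\<dots> \<le> exp 2" by (rule exp_lower_Taylor_quadratic) simp
    finally show ?thesis by (simp add: exp_minus field_simps)
  qed
  then have 1: "(\<lambda>n. (4 * exp (- 2 :: real)) ^ n) \<longlonglongrightarrow> 0" by (intro LIMSEQ_power_zero) simp
  have 2: "(\<lambda>n. 1 / sqrt (real n)) \<longlonglongrightarrow> 0" by real_asymp
  have 3: "(\<lambda>n. 1 / real n) \<longlonglongrightarrow> 0" by real_asymp
  show ?thesis
    using tendsto_add[OF tendsto_add[OF tendsto_mult_left[OF 1, of 2] 2] 3]
    unfolding failure_bound_def[abs_def] by simp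
qed

section \<open>Assembling the bounds for sparse and dense scans\<close>

lemma prob_not_good_le:
  assumes k: "k \<ge> 2" and n: "4 * k \<le> n" and m: "real m / real n \<ge> density_threshold k"
    and m2: "2 * m \<le> card (k_clauses k n)"
  shows "draw_avg m (k_clauses k n) (\<lambda>xs. of_bool (\<not> good_formula (2 / 3 * \<kappa> k) (real k) n m (scan n xs)))
    \<le> failure_bound n"
proof -
  let ?U = "k_clauses k n" and ?c = "2 / 3 * \<kappa> k"
  note \<kappa> = \<kappa>_bounds[OF k]
  define y where "y = exp (- ?c * real m / real n)"
  \<comment> \<open>\<open>r\<close> is the least integer above \<open>y * n\<close>, so fewer than
    \<open>r\<close> unfrozen variables means at most \<open>y * n\<close> of them. The choice of
    \<open>j\<close> gives \<open>j - 1 \<le> ln n\<close>, hence the component bound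
    \<open>k * ln n\<close>.\<close>
  define r where "r = nat \<lfloor>y * real n\<rfloor> + 1"
  define j where "j = nat \<lceil>ln (real n)\<rceil>"
  have n8: "n \<ge> 8" using k n by linarith
  have y0: "y > 0" by (simp add: y_def)
  have r: "y * real n \<le> real r" "r \<ge> 1" unfolding r_def by linarith+
  have ln1: "ln (real n) \<ge> 1"
  proof -
    have "exp 1 \<le> real n" using exp_le n8 by linarith
    then show ?thesis using n8 by (subst ln_ge_iff) auto
  qed
  then have j: "j \<ge> 1" "ln (real n) \<le> real j" "real (j - 1) \<le> ln (real n)"
    unfolding j_def by linarith+
  have "y \<le> exp (- 1)"
  proof -
    have "81 / \<kappa> k \<le> real m / real n" using density_threshold_ge[OF k] m by linarith
    then have "?c * (81 / \<kappa> k) \<le> ?c * (real m / real n)" using \<kappa> by (intro mult_left_mono) auto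
    moreover have "?c * (81 / \<kappa> k) = 54" using \<kappa> by simp
    ultimately have "- ?c * real m / real n \<le> - 1" by simp
    then show ?thesis unfolding y_def by (subst exp_le_cancel_iff)
  qed
  note second = nonfrozen_term_le[OF y0 this _ r(2,1)]
  have m12: "m div 2 + (m - m div 2) = m" "m div 2 \<le> m - m div 2" by auto
  have "draw_avg m ?U (\<lambda>xs. of_bool (\<not> good_formula ?c (real k) n m (scan n xs))) \<le>
    draw_avg m ?U (\<lambda>xs. of_bool (r \<le> card (nonfrozen_vars n (scan n xs)) \<or>
      large_component n (k * (j - 1)) (scan n xs)))"
  proof (rule draw_avg_mono)
    fix xs
    let ?F = "scan n xs"
    have "good_formula ?c (real k) n m ?F"
      if "\<not> r \<le> card (nonfrozen_vars n ?F)" and l: "\<not> large_component n (k * (j - 1)) ?F"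
    proof (rule good_formulaI)
      have "card (nonfrozen_vars n ?F) \<le> nat \<lfloor>y * real n\<rfloor>" using that(1) unfolding r_def by simp
      then have "real (card (nonfrozen_vars n ?F)) \<le> y * real n"
        using mult_nonneg_nonneg[of y "real n"] y0 by linarith
      then show "real (card (nonfrozen_vars n ?F)) \<le> exp (- ?c * real m / real n) * real n"
        by (simp add: y_def)
    next
      fix K assume K: "K \<in> formula_components (nonfrozen_vars n ?F) (induced_nonfrozen n ?F)"
      show "real (card K) \<le> real k * ln (real n)"
      proof (cases "card K < 2")
        case True
        have "1 * 1 \<le> real k * ln (real n)" using k ln1 by (intro mult_mono) auto
        then show ?thesis using True by simp
      next
        case False
        then have "card K \<le> k * (j - 1)" using l K unfolding large_component_def by force
        then have "real (card K) \<le> real k * real (j - 1)" by (metis of_nat_le_iff of_nat_mult)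
        also have "\<dots> \<le> real k * ln (real n)" using j by (intro mult_left_mono) auto
        finally show ?thesis .
      qed
    qed (use satisfiable_scan n8 in auto)
    then show "of_bool (\<not> good_formula ?c (real k) n m ?F) \<le>
      (of_bool (r \<le> card (nonfrozen_vars n ?F) \<or> large_component n (k * (j - 1)) ?F) :: real)"
      by auto
  qed
  also have "\<dots> \<le> 2 * 4 ^ n * exp (- \<kappa> k * real (m div 2)) +
      real (n choose r) * exp (- 2 * \<kappa> k * r * m / n) +
      card ?U * (real (k * (2 ^ k * n ^ (k - 1))) ^ (j - 1) * exp j * (real k ^ j *
        ((6 * real m / card ?U) ^ j * exp (- 2 * \<kappa> k * j * m / n))))"
    using prob_bad_le[OF k n, of "m div 2" "m - m div 2" j r] m2 m12 j(1) by simp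
  also have "\<dots> \<le> failure_bound n"
    unfolding failure_bound_def
  proof (intro add_mono)
    show "2 * 4 ^ n * exp (- \<kappa> k * real (m div 2)) \<le> 2 * (4 * exp (- 2)) ^ n"
      using discriminating_term_le[OF k _ m] n8 by simp
    \<comment> \<open>The rate \<open>2 / 3 * \<kappa> k\<close> in \<open>y\<close> is one third of
      the rate in the union bound, leaving the three factors that \<open>nonfrozen_term_le\<close>
      spends.\<close>
    have "y ^ (3 * r) = exp (- 2 * \<kappa> k * r * m / n)"
      unfolding y_def by (simp add: field_simps flip: exp_of_nat_mult)
    then show "real (n choose r) * exp (- 2 * \<kappa> k * r * m / n) \<le> 1 / sqrt (real n)"
      using second n8 by simp
  qed (use component_term_le[OF k _ m j(1,2)] n in simp)
  finally show ?thesis .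
qed

text \<open>Once more than half of the clauses have been scanned every variable is already frozen with
  high probability, and this persists.\<close>

lemma prob_not_good_dense:
  assumes k: "k \<ge> 2" and n: "4 * k \<le> n" and m: "m \<le> card (k_clauses k n)" "card (k_clauses k n) < 2 * m"
    and c: "2 * real n / (real k)\<^sup>2 - 1 \<ge> density_threshold k"
    and frozen: "exp (- (2 / 3 * \<kappa> k) * (2 * real n / (real k)\<^sup>2 - 1)) * real n < 1"
  shows "draw_avg m (k_clauses k n) (\<lambda>xs. of_bool (\<not> good_formula (2 / 3 * \<kappa> k) (real k) n m (scan n xs)))
    \<le> failure_bound n"
proof -
  let ?U = "k_clauses k n" and ?c = "2 / 3 * \<kappa> k"
  let ?v = "2 * real n / (real k)\<^sup>2 - 1"
  note \<kappa> = \<kappa>_bounds[OF k]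
  \<comment> \<open>The longest prefix to which \<open>prob_not_good_le\<close> applies. Because
    \<open>k \<ge> 2\<close>, its density is at least \<open>?v\<close>, which grows linearly in
    \<open>n\<close>.\<close>
  define l where "l = card ?U div 2"
  have n0: "real n \<ge> 1" using k n by linarith
  have "(2 * real n / real k)\<^sup>2 \<le> (2 * real n / real k) ^ k"
    using k n by (intro power_increasing) (auto simp: field_simps)
  also have "\<dots> \<le> real (card ?U)" using n by (intro card_k_clauses_lower) auto
  finally have "(2 * real n / real k)\<^sup>2 \<le> 2 * real l + 1" unfolding l_def by linarith
  moreover have "(2 * real n / real k)\<^sup>2 = 2 * (2 * real n / (real k)\<^sup>2 * real n)"
    by (simp add: power2_eq_square)
  ultimately have "?v * real n \<le> real l" using n0 by (simp add: left_diff_distrib)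
  then have l: "?v \<le> real l / real n" using n0 by (simp add: field_simps)
  have "- ?c * real l / real n \<le> - ?c * ?v" using l \<kappa> mult_left_mono[OF l, of ?c] by simp
  then have "exp (- ?c * real l / real n) * real n \<le> exp (- ?c * ?v) * real n"
    using n0 by (intro mult_right_mono) auto
  then have one: "exp (- ?c * real l / real n) * real n < 1" using frozen by linarith
  obtain d where d: "m = l + d" using m unfolding l_def by (metis le_add_diff_inverse less_imp_le less_mult_imp_div_less mult.commute)
  have persist: "good_formula ?c (real k) n m (scan n xs)"
    if "good_formula ?c (real k) n l (scan n (take l xs))" for xs
  proof -
    \<comment> \<open>Fewer than one non-frozen variable means none, and then all three properties
      are trivial for every \<open>m\<close>.\<close>
    have "real (card (nonfrozen_vars n (scan n (take l xs)))) < 1"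
      using that one unfolding good_formula_def by linarith
    then have "nonfrozen_vars n (scan n (take l xs)) = {}" by simp
    then have "nonfrozen_vars n (scan n xs) = {}"
      using nonfrozen_vars_antimono[OF scan_append_mono, of n n "take l xs" "drop l xs"] by simp
    then show ?thesis
      using satisfiable_scan n0 by (intro good_formulaI) (auto simp: formula_components_def)
  qed
  have "draw_avg m ?U (\<lambda>xs. of_bool (\<not> good_formula ?c (real k) n m (scan n xs))) \<le>
      draw_avg m ?U (\<lambda>xs. of_bool (\<not> good_formula ?c (real k) n l (scan n (take l xs))))"
    using persist by (intro draw_avg_mono) auto
  also have "\<dots> \<le> draw_avg l ?U (\<lambda>h. of_bool (\<not> good_formula ?c (real k) n l (scan n h)))"
    unfolding d by (rule draw_avg_take_le) simp
  also have "\<dots> \<le> failure_bound n"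
    by (rule prob_not_good_le[OF k n]) (use l c in \<open>auto simp: l_def\<close>)
  finally show ?thesis .
qed

lemma P_sat_good_whp:
  assumes k: "k \<ge> 2"
    and m: "\<forall>\<^sub>F n in sequentially. real (m n) / real n \<ge> density_threshold k \<and> m n \<le> 2 ^ k * (n choose k)"
  shows "(\<lambda>n. measure_pmf.prob (P_sat k n (m n)) {F. good_formula (2 / 3 * \<kappa> k) (real k) n (m n) F})
    \<longlonglongrightarrow> 1"
proof -
  let ?P = "\<lambda>n. measure_pmf.prob (P_sat k n (m n)) {F. good_formula (2 / 3 * \<kappa> k) (real k) n (m n) F}"
  define a where "a = 2 / 3 * \<kappa> k"
  define b where "b = 2 / (real k)\<^sup>2"
  have ab: "a > 0" "b > 0" using \<kappa>_bounds[OF k] k by (simp_all add: a_def b_def)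
  have "filterlim (\<lambda>n. b * real n - 1) at_top sequentially" using ab by real_asymp
  then have e1: "\<forall>\<^sub>F n in sequentially. b * real n - 1 \<ge> density_threshold k"
    by (simp add: filterlim_at_top)
  have "(\<lambda>n. exp (- a * (b * real n - 1)) * real n) \<longlonglongrightarrow> 0" using ab by real_asymp
  then have e2: "\<forall>\<^sub>F n in sequentially. exp (- a * (b * real n - 1)) * real n < 1"
    by (rule order_tendstoD) simp
  have "\<forall>\<^sub>F n in sequentially. 1 - failure_bound n \<le> ?P n"
    using m e1 e2 eventually_ge_at_top[of "4 * k"]
  proof eventually_elim
    case (elim n)
    have "draw_avg (m n) (k_clauses k n)
        (\<lambda>xs. of_bool (\<not> good_formula (2 / 3 * \<kappa> k) (real k) n (m n) (scan n xs))) \<le> failure_bound n"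
    proof (cases "2 * m n \<le> card (k_clauses k n)")
      case True
      then show ?thesis using prob_not_good_le[OF k elim(4)] elim(1) by simp
    next
      case False
      then show ?thesis using prob_not_good_dense[OF k elim(4)] elim(1-3)
        by (simp add: a_def b_def card_k_clauses)
    qed
    then show ?case using prob_P_sat[of "m n" k n] elim(1) by simp
  qed
  moreover have "(\<lambda>n. 1 - failure_bound n) \<longlonglongrightarrow> 1"
    using tendsto_diff[OF tendsto_const failure_bound_tendsto, of 1] by simp
  ultimately show ?thesis
    by (intro tendsto_sandwich[of "\<lambda>n. 1 - failure_bound n" ?P sequentially "\<lambda>_. 1"]) auto
qed

theorem theorem1:
  fixes k :: nat
  shows "\<exists>c>0::real. \<exists>c'>0::real. \<exists>L>0::real. \<forall>m :: nat \<Rightarrow> nat.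
    (\<forall>\<^sub>F n in sequentially. real (m n) / real n \<ge> c \<and> m n \<le> 2 ^ k * (n choose k)) \<longrightarrow>
    (\<lambda>n. measure_pmf.prob (P_sat k n (m n))
       {F. real (card (nonfrozen_vars n F)) \<le> exp (- c' * real (m n) / real n) * real n \<and>
           (\<forall>K \<in> formula_components (nonfrozen_vars n F) (induced_nonfrozen n F).
              real (card K) \<le> L * ln (real n)) \<and>
           1 / real n * ln (real (card (sat_assignments n F)))
             \<le> exp (- c' * real (m n) / real n)})
      \<longlonglongrightarrow> 1"
proof (cases "k \<ge> 2")
  case True
  note \<kappa> = \<kappa>_bounds[OF True]
  show ?thesis
  proof (intro exI conjI allI impI)
    show "density_threshold k > 0" "2 / 3 * \<kappa> k > 0" "real k > 0"
      using True \<kappa> by (simp_all add: density_threshold_def)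
    fix m :: "nat \<Rightarrow> nat"
    assume "\<forall>\<^sub>F n in sequentially. real (m n) / real n \<ge> density_threshold k \<and> m n \<le> 2 ^ k * (n choose k)"
    from P_sat_good_whp[OF True this]
    show "(\<lambda>n. measure_pmf.prob (P_sat k n (m n))
       {F. real (card (nonfrozen_vars n F)) \<le> exp (- (2 / 3 * \<kappa> k) * real (m n) / real n) * real n \<and>
           (\<forall>K \<in> formula_components (nonfrozen_vars n F) (induced_nonfrozen n F).
              real (card K) \<le> real k * ln (real n)) \<and>
           1 / real n * ln (real (card (sat_assignments n F)))
             \<le> exp (- (2 / 3 * \<kappa> k) * real (m n) / real n)}) \<longlonglongrightarrow> 1"
      unfolding good_formula_def .
  qed
next
  case False
  text \<open>There are at most \<open>2 n\<close> clauses, so the density \<open>3\<close> is never reached.\<close>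
  have "\<not> (\<forall>\<^sub>F n in sequentially. real (m n) / real n \<ge> 3 \<and> m n \<le> 2 ^ k * (n choose k))" for m :: "nat \<Rightarrow> nat"
  proof
    assume "\<forall>\<^sub>F n in sequentially. real (m n) / real n \<ge> 3 \<and> m n \<le> 2 ^ k * (n choose k)"
    then have "\<forall>\<^sub>F n in sequentially. False"
      using eventually_gt_at_top[of 0]
    proof eventually_elim
      case (elim n)
      have "k = 0 \<or> k = 1" using False by auto
      then have "2 ^ k * (n choose k) \<le> 2 * n" using elim(2) by auto
      then have "real (m n) \<le> 2 * real n" using elim(1) by linarith
      then show False using elim by (simp add: field_simps)
    qed
    then show False by simp
  qed
  then show ?thesis by (intro exI[of _ 3] exI[of _ 1] conjI allI impI) auto
qed

end
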